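(* For every $n\in\mathbb{N}$, the Plactic monoid $M_n$ of rank $n$ has finite derivation type.
   Context: Let $n \in \mathbb{N}=\{1,2,\ldots\}$ and let $A = \{1<2<\cdots<n\}$. The Plactic monoid $M_n$ is the monoid presented by $\langle A \mid \mathcal{R}\rangle$, where $\mathcal{R} = \{(xzy,zxy) : x \le y < z\} \cup \{(yxz,yzx) : x<y\le z\}$ with $x,y,z\in A$. Finite derivation type (Squier): Let $\langle X\mid\mathcal{S}\rangle$ be a monoid presentation. Its derivation graph has vertex set $X^*$ and, for each $u,v\in X^*$, each $(l,r)\in\mathcal{S}$ and each $\epsilon=\pm1$, an edge $(u,(l,r),\epsilon,v)$ going from $ulv$ to $urv$ if $\epsilon=1$ and from $urv$ to $ulv$ if $\epsilon=-1$; edges differing only in $\epsilon$ are mutually inverse. The monoid $X^*$ acts on the left and right of the graph by concatenation: $x\cdot(u,s,\epsilon,v)\cdot y=(xu,s,\epsilon,vy)$, and this extends to paths. For a path $p$, $\iota p$ and $\tau p$ denote its initial and terminal vertices, and two paths are parallel if they have the same initial and the same terminal vertices. A homotopy relation is an equivalence relation $\sim$ on paths, contained in the parallelism relation, such that: (a) $(e_1\cdot\iota e_2)(\tau e_1\cdot e_2)\sim(\iota e_1\cdot e_2)(e_1\cdot\tau e_2)$ for all edges $e_1,e_2$; (b) $p\sim q$ implies $x\cdot p\cdot y\sim x\cdot q\cdot y$ for all $x,y\in X^*$; (c) $p\sim q$ implies $rps\sim rqs$ whenever these path compositions are defined; (d) $pp^{-1}\sim 1_{\iota p}$ for every path $p$,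 where $1_{\iota p}$ is the empty path at $\iota p$. A finite presentation has finite derivation type if there is a finite set of pairs of parallel paths such that the smallest homotopy relation containing it is the whole parallelism relation. A monoid has finite derivation type if it has a finite presentation having finite derivation type (this is known to be independent of the choice of finite presentation). *)

theory Defs
  imports "HOL-Algebra.Group"
begin

section \<open>Monoid presentations\<close>

text \<open>Words over the alphabet \<open>X\<close> are the elements of \<open>lists X\<close>; a set of defining relations is a
  set \<open>S\<close> of pairs of words.\<close>

definition presentation :: "'a set \<Rightarrow> ('a list \<times> 'a list) set \<Rightarrow> bool" where
  "presentation X S \<longleftrightarrow> S \<subseteq> lists X \<times> lists X"

definition finite_presentation :: "'a set \<Rightarrow> ('a list \<times> 'a list) set \<Rightarrow> bool" where
  "finite_presentation X S \<longleftrightarrow> presentation X S \<and> finite X \<and> finite S"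

inductive_set presented_congruence ::
  "'a set \<Rightarrow> ('a list \<times> 'a list) set \<Rightarrow> ('a list \<times> 'a list) set"
  for X :: "'a set" and S :: "('a list \<times> 'a list) set" where
  rel: "\<lbrakk>u \<in> lists X; v \<in> lists X; (l, r) \<in> S\<rbrakk>
    \<Longrightarrow> (u @ l @ v, u @ r @ v) \<in> presented_congruence X S"
| refl: "w \<in> lists X \<Longrightarrow> (w, w) \<in> presented_congruence X S"
| sym: "(w, w') \<in> presented_congruence X S \<Longrightarrow> (w', w) \<in> presented_congruence X S"
| trans: "\<lbrakk>(w, w') \<in> presented_congruence X S; (w', w'') \<in> presented_congruence X S\<rbrakk>
    \<Longrightarrow> (w, w'') \<in> presented_congruence X S"

definition presented_monoid ::
  "'a set \<Rightarrow> ('a list \<times> 'a list) set \<Rightarrow> 'a list set monoid" where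
  "presented_monoid X S =
    \<lparr>carrier = lists X // presented_congruence X S,
     mult = (\<lambda>C D. \<Union>c\<in>C. \<Union>d\<in>D. presented_congruence X S `` {c @ d}),
     one = presented_congruence X S `` {[]}\<rparr>"

lemma presented_congruence_lists:
  assumes "presentation X S" and "(w, w') \<in> presented_congruence X S"
  shows "w \<in> lists X \<and> w' \<in> lists X"
  using assms(2,1) by induction (auto simp: presentation_def)

lemma equiv_presented_congruence:
  assumes "presentation X S"
  shows "equiv (lists X) (presented_congruence X S)"
  using presented_congruence_lists[OF assms]
  by (intro equivI refl_onI symI transI)
    (auto intro: presented_congruence.intros)

lemma presented_congruence_context:
  assumes "(w, w') \<in> presented_congruence X S" and "x \<in> lists X" and "y \<in> lists X"
  shows "(x @ w @ y, x @ w' @ y) \<in> presented_congruence X S"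
  using assms
proof induction
  case (rel u v l r)
  then have "((x @ u) @ l @ (v @ y), (x @ u) @ r @ (v @ y)) \<in> presented_congruence X S"
    by (intro presented_congruence.rel) auto
  then show ?case by simp
next
  case (refl w)
  then show ?case by (intro presented_congruence.refl) auto
qed (blast intro: presented_congruence.intros)+

lemma presented_congruence_append:
  assumes "presentation X S"
    and "(c, c') \<in> presented_congruence X S" and "(d, d') \<in> presented_congruence X S"
  shows "(c @ d, c' @ d') \<in> presented_congruence X S"
proof -
  have "(c @ d, c' @ d) \<in> presented_congruence X S"
    using presented_congruence_context[OF assms(2), of "[]" d]
      presented_congruence_lists[OF assms(1,3)] by simp
  moreover have "(c' @ d, c' @ d') \<in> presented_congruence X S"
    using presented_congruence_context[OF assms(3), of c' "[]"]
      presented_congruence_lists[OF assms(1,2)] by simp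
  ultimately show ?thesis by (rule presented_congruence.trans)
qed

lemma presented_mult_class:
  assumes "presentation X S" and "c \<in> lists X" and "d \<in> lists X"
  shows "presented_congruence X S `` {c} \<otimes>\<^bsub>presented_monoid X S\<^esub> presented_congruence X S `` {d}
    = presented_congruence X S `` {c @ d}"
proof -
  have "congruent2 (presented_congruence X S) (presented_congruence X S)
      (\<lambda>c d. presented_congruence X S `` {c @ d})"
    unfolding congruent2_def
    using equiv_class_eq[OF equiv_presented_congruence[OF assms(1)]
        presented_congruence_append[OF assms(1)]]
    by blast
  from UN_equiv_class2[OF equiv_presented_congruence[OF assms(1)]
      equiv_presented_congruence[OF assms(1)] this assms(2,3)]
  show ?thesis by (simp add: presented_monoid_def)
qed

lemma monoid_presented_monoid:
  assumes "presentation X S"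
  shows "monoid (presented_monoid X S)"
proof -
  define cl where "cl = (\<lambda>w. presented_congruence X S `` {w})"
  let ?M = "presented_monoid X S"
  have car: "carrier ?M = cl ` lists X"
    by (auto simp: presented_monoid_def quotient_def cl_def)
  have one: "\<one>\<^bsub>?M\<^esub> = cl []"
    by (simp add: presented_monoid_def cl_def)
  have mult: "cl c \<otimes>\<^bsub>?M\<^esub> cl d = cl (c @ d)" if "c \<in> lists X" "d \<in> lists X" for c d
    using presented_mult_class[OF assms that] by (simp add: cl_def)
  show ?thesis
    by (rule monoidI) (auto simp: car one mult del: in_listsI in_listsD)
qed

section \<open>Derivation graphs\<close>

text \<open>In an edge \<open>(u, (l, r), \<epsilon>, v)\<close> the sign is a Boolean: \<open>True\<close> encodes \<open>\<epsilon> = 1\<close> and \<open>False\<close>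
  encodes \<open>\<epsilon> = -1\<close>.\<close>

type_synonym 'a edge = "'a list \<times> ('a list \<times> 'a list) \<times> bool \<times> 'a list"

definition edges :: "'a set \<Rightarrow> ('a list \<times> 'a list) set \<Rightarrow> 'a edge set" where
  "edges X S = lists X \<times> S \<times> UNIV \<times> lists X"

fun edge_src :: "'a edge \<Rightarrow> 'a list" where
  "edge_src (u, (l, r), \<epsilon>, v) = (if \<epsilon> then u @ l @ v else u @ r @ v)"

fun edge_tgt :: "'a edge \<Rightarrow> 'a list" where
  "edge_tgt (u, (l, r), \<epsilon>, v) = (if \<epsilon> then u @ r @ v else u @ l @ v)"

fun edge_inv :: "'a edge \<Rightarrow> 'a edge" where
  "edge_inv (u, s, \<epsilon>, v) = (u, s, \<not> \<epsilon>, v)"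

fun edge_act :: "'a list \<Rightarrow> 'a edge \<Rightarrow> 'a list \<Rightarrow> 'a edge" where
  "edge_act x (u, s, \<epsilon>, v) y = (x @ u, s, \<epsilon>, v @ y)"

text \<open>A path is its initial vertex together with its list of edges, so that there is one empty path
  at each vertex.\<close>

type_synonym 'a dpath = "'a list \<times> 'a edge list"

fun walk :: "'a list \<Rightarrow> 'a edge list \<Rightarrow> bool" where
  "walk w [] \<longleftrightarrow> True"
| "walk w (e # es) \<longleftrightarrow> edge_src e = w \<and> walk (edge_tgt e) es"

definition paths :: "'a set \<Rightarrow> ('a list \<times> 'a list) set \<Rightarrow> 'a dpath set" where
  "paths X S = {(w, es). w \<in> lists X \<and> set es \<subseteq> edges X S \<and> walk w es}"

definition path_src :: "'a dpath \<Rightarrow> 'a list" where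
  "path_src p = fst p"

definition path_tgt :: "'a dpath \<Rightarrow> 'a list" where
  "path_tgt p = (if snd p = [] then fst p else edge_tgt (last (snd p)))"

definition empty_path :: "'a list \<Rightarrow> 'a dpath" where
  "empty_path w = (w, [])"

definition edge_path :: "'a edge \<Rightarrow> 'a dpath" where
  "edge_path e = (edge_src e, [e])"

text \<open>Meaningful only if \<open>path_tgt p = path_src q\<close>.\<close>

definition path_comp :: "'a dpath \<Rightarrow> 'a dpath \<Rightarrow> 'a dpath"  (infixr \<open>\<cdot>\<close> 70) where
  "p \<cdot> q = (fst p, snd p @ snd q)"

definition path_inv :: "'a dpath \<Rightarrow> 'a dpath" where
  "path_inv p = (path_tgt p, rev (map edge_inv (snd p)))"

definition path_act :: "'a list \<Rightarrow> 'a dpath \<Rightarrow> 'a list \<Rightarrow> 'a dpath" where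
  "path_act x p y = (x @ fst p @ y, map (\<lambda>e. edge_act x e y) (snd p))"

definition parallelism :: "'a set \<Rightarrow> ('a list \<times> 'a list) set \<Rightarrow> ('a dpath \<times> 'a dpath) set" where
  "parallelism X S = {(p, q). p \<in> paths X S \<and> q \<in> paths X S \<and>
     path_src p = path_src q \<and> path_tgt p = path_tgt q}"

section \<open>Homotopy relations and finite derivation type\<close>

definition homotopy_relation ::
  "'a set \<Rightarrow> ('a list \<times> 'a list) set \<Rightarrow> ('a dpath \<times> 'a dpath) set \<Rightarrow> bool" where
  "homotopy_relation X S H \<longleftrightarrow>
     equiv (paths X S) H \<and>
     H \<subseteq> parallelism X S \<and>
     (\<forall>e1 \<in> edges X S. \<forall>e2 \<in> edges X S.
        (path_act [] (edge_path e1) (edge_src e2) \<cdot> path_act (edge_tgt e1) (edge_path e2) [],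
         path_act (edge_src e1) (edge_path e2) [] \<cdot> path_act [] (edge_path e1) (edge_tgt e2)) \<in> H) \<and>
     (\<forall>p q. \<forall>x \<in> lists X. \<forall>y \<in> lists X.
        (p, q) \<in> H \<longrightarrow> (path_act x p y, path_act x q y) \<in> H) \<and>
     (\<forall>p q. \<forall>r \<in> paths X S. \<forall>s \<in> paths X S.
        (p, q) \<in> H \<and> path_tgt r = path_src p \<and> path_tgt p = path_src s
        \<longrightarrow> (r \<cdot> p \<cdot> s, r \<cdot> q \<cdot> s) \<in> H) \<and>
     (\<forall>p \<in> paths X S. (p \<cdot> path_inv p, empty_path (path_src p)) \<in> H)"

definition generated_homotopy ::
  "'a set \<Rightarrow> ('a list \<times> 'a list) set \<Rightarrow> ('a dpath \<times> 'a dpath) set \<Rightarrow> ('a dpath \<times> 'a dpath) set" where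
  "generated_homotopy X S B = \<Inter>{H. homotopy_relation X S H \<and> B \<subseteq> H}"

definition fdt_presentation :: "'a set \<Rightarrow> ('a list \<times> 'a list) set \<Rightarrow> bool" where
  "fdt_presentation X S \<longleftrightarrow> finite_presentation X S \<and>
     (\<exists>B. finite B \<and> B \<subseteq> parallelism X S \<and> generated_homotopy X S B = parallelism X S)"

text \<open>The alphabet of a finite presentation is finite, so it can be taken to consist of natural
  numbers. \<open>M\<close> is meant to be a monoid.\<close>

definition fdt_monoid :: "('m, 'b) monoid_scheme \<Rightarrow> bool" where
  "fdt_monoid M \<longleftrightarrow>
     (\<exists>(X :: nat set) S. presented_monoid X S \<cong> M \<and> fdt_presentation X S)"

text \<open>\<open>generated_homotopy\<close> is the smallest homotopy relation containing \<open>B\<close>; the intersection is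
  over a nonempty family because parallelism is itself a homotopy relation.\<close>

lemma walk_append:
  "walk w (es @ fs) \<longleftrightarrow> walk w es \<and> walk (path_tgt (w, es)) fs"
proof (induction es arbitrary: w)
  case (Cons e es)
  have "path_tgt (w, e # es) = path_tgt (edge_tgt e, es)"
    by (simp add: path_tgt_def)
  with Cons show ?case by simp
qed (simp add: path_tgt_def)

lemma edge_src_inv [simp]: "edge_src (edge_inv e) = edge_tgt e"
  and edge_tgt_inv [simp]: "edge_tgt (edge_inv e) = edge_src e"
  and edge_src_act [simp]: "edge_src (edge_act x e y) = x @ edge_src e @ y"
  and edge_tgt_act [simp]: "edge_tgt (edge_act x e y) = x @ edge_tgt e @ y"
  by (cases e rule: edge_src.cases; simp)+

lemma edge_inv_in_edges: "e \<in> edges X S \<Longrightarrow> edge_inv e \<in> edges X S"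
  and edge_act_in_edges:
    "\<lbrakk>e \<in> edges X S; x \<in> lists X; y \<in> lists X\<rbrakk> \<Longrightarrow> edge_act x e y \<in> edges X S"
  by (cases e rule: edge_src.cases; simp add: edges_def)+

lemma edge_src_in_lists: "\<lbrakk>presentation X S; e \<in> edges X S\<rbrakk> \<Longrightarrow> edge_src e \<in> lists X"
  and edge_tgt_in_lists: "\<lbrakk>presentation X S; e \<in> edges X S\<rbrakk> \<Longrightarrow> edge_tgt e \<in> lists X"
  by (cases e rule: edge_src.cases; auto simp: edges_def presentation_def)+

lemma path_src_simps [simp]:
  "path_src (p \<cdot> q) = path_src p"
  "path_src (path_inv p) = path_tgt p"
  "path_src (path_act x p y) = x @ path_src p @ y"
  "path_src (edge_path e) = edge_src e"
  "path_src (empty_path w) = w"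
  by (simp_all add: path_src_def path_comp_def path_inv_def path_act_def edge_path_def
      empty_path_def)

lemma path_tgt_simps [simp]:
  "path_tgt p = path_src q \<Longrightarrow> path_tgt (p \<cdot> q) = path_tgt q"
  "path_tgt (path_act x p y) = x @ path_tgt p @ y"
  "path_tgt (edge_path e) = edge_tgt e"
  "path_tgt (empty_path w) = w"
  by (auto simp: path_src_def path_tgt_def path_comp_def path_act_def edge_path_def
      empty_path_def last_map)

lemma path_tgt_inv [simp]: "p \<in> paths X S \<Longrightarrow> path_tgt (path_inv p) = path_src p"
  by (cases "snd p") (auto simp: paths_def path_tgt_def path_inv_def path_src_def)

lemma path_comp_in_paths:
  "\<lbrakk>p \<in> paths X S; q \<in> paths X S; path_tgt p = path_src q\<rbrakk> \<Longrightarrow> p \<cdot> q \<in> paths X S"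
  by (auto simp: paths_def path_comp_def path_src_def walk_append)

lemma path_tgt_in_lists:
  assumes "presentation X S" and "p \<in> paths X S"
  shows "path_tgt p \<in> lists X"
proof (cases "snd p = []")
  case True
  then show ?thesis using assms by (auto simp: paths_def path_tgt_def)
next
  case False
  then have "last (snd p) \<in> edges X S"
    using assms(2) last_in_set[of "snd p"] by (auto simp: paths_def simp del: last_in_set)
  from edge_tgt_in_lists[OF assms(1) this] False show ?thesis
    by (simp add: path_tgt_def)
qed

lemma walk_inv: "walk w es \<Longrightarrow> walk (path_tgt (w, es)) (rev (map edge_inv es))"
proof (induction es arbitrary: w)
  case (Cons e es)
  have t: "path_tgt (w, e # es) = path_tgt (edge_tgt e, es)"
    by (simp add: path_tgt_def)
  have "path_tgt (path_tgt (edge_tgt e, es), rev (map edge_inv es)) = edge_tgt e"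
    using Cons.prems by (cases es) (auto simp: path_tgt_def)
  with Cons show ?case by (simp add: t walk_append)
qed simp

lemma path_inv_in_paths:
  assumes "presentation X S" and "p \<in> paths X S"
  shows "path_inv p \<in> paths X S"
proof -
  have "set (snd p) \<subseteq> edges X S" and "walk (fst p) (snd p)"
    using assms(2) by (auto simp: paths_def)
  then have "edge_inv ` set (snd p) \<subseteq> edges X S"
    and "walk (path_tgt p) (rev (map edge_inv (snd p)))"
    using edge_inv_in_edges[of _ X S] walk_inv[of "fst p" "snd p"] by (blast, simp)
  then show ?thesis
    using path_tgt_in_lists[OF assms] by (simp add: paths_def path_inv_def)
qed

lemma walk_act: "walk w es \<Longrightarrow> walk (x @ w @ y) (map (\<lambda>e. edge_act x e y) es)"
  by (induction es arbitrary: w) auto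

lemma path_act_in_paths:
  "\<lbrakk>p \<in> paths X S; x \<in> lists X; y \<in> lists X\<rbrakk> \<Longrightarrow> path_act x p y \<in> paths X S"
  using edge_act_in_edges[of _ X S x y]
  by (auto simp: paths_def path_act_def walk_act simp del: split_paired_All)

lemma edge_path_in_paths:
  "\<lbrakk>presentation X S; e \<in> edges X S\<rbrakk> \<Longrightarrow> edge_path e \<in> paths X S"
  using edge_src_in_lists[of X S e] by (auto simp: paths_def edge_path_def)

lemma homotopy_relation_parallelism:
  assumes "presentation X S"
  shows "homotopy_relation X S (parallelism X S)"
proof -
  have *: "r \<cdot> p \<cdot> s \<in> paths X S \<and> r \<cdot> q \<cdot> s \<in> paths X S \<and>
      path_tgt (p \<cdot> s) = path_tgt (q \<cdot> s)"
    if "r \<in> paths X S" "s \<in> paths X S" "p \<in> paths X S" "q \<in> paths X S"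
      and "path_src p = path_src q" "path_tgt p = path_tgt q"
      and "path_tgt r = path_src p" "path_tgt p = path_src s" for p q r s
  proof -
    from that have "path_tgt q = path_src s" "path_tgt r = path_src q" by simp_all
    with that(1-4,7,8) show ?thesis by (simp add: path_comp_in_paths)
  qed
  have "equiv (paths X S) (parallelism X S)"
    by (intro equivI refl_onI symI transI) (auto simp: parallelism_def)
  moreover have "empty_path (path_src p) \<in> paths X S" if "p \<in> paths X S" for p
    using that by (auto simp: paths_def empty_path_def path_src_def)
  ultimately show ?thesis
    unfolding homotopy_relation_def parallelism_def
    using edge_src_in_lists[OF assms] edge_tgt_in_lists[OF assms] edge_path_in_paths[OF assms]
      path_inv_in_paths[OF assms]
    by (simp add: path_comp_in_paths path_act_in_paths del: split_paired_All)
      (intro allI ballI impI, elim conjE, rule *, assumption+)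
qed

lemma homotopy_relation_generated:
  assumes "presentation X S" and "B \<subseteq> parallelism X S"
  shows "homotopy_relation X S (generated_homotopy X S B)"
proof -
  define F where "F = {H. homotopy_relation X S H \<and> B \<subseteq> H}"
  have P: "parallelism X S \<in> F"
    using homotopy_relation_parallelism assms by (auto simp: F_def)
  have F: "homotopy_relation X S H" if "H \<in> F" for H
    using that by (simp add: F_def)
  have eq: "equiv (paths X S) H" if "H \<in> F" for H
    using F[OF that] by (simp add: homotopy_relation_def)
  have "equiv (paths X S) (\<Inter>F)"
  proof (rule equivI)
    show "\<Inter>F \<subseteq> paths X S \<times> paths X S" using P by (auto simp: parallelism_def)
    show "refl_on (paths X S) (\<Inter>F)"
      using eq by (auto simp: equiv_def refl_on_def)
    show "sym (\<Inter>F)" using eq by (meson InterE InterI equiv_def sym_def)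
    show "trans (\<Inter>F)" using eq by (meson InterE InterI equiv_def trans_def)
  qed
  moreover have "\<Inter>F \<subseteq> parallelism X S" using P by blast
  ultimately have "homotopy_relation X S (\<Inter>F)"
    using F unfolding homotopy_relation_def by (simp add: Ball_def del: split_paired_All)
  then show ?thesis by (simp add: generated_homotopy_def F_def)
qed

section \<open>The Plactic monoid\<close>

definition plactic_relations :: "nat \<Rightarrow> (nat list \<times> nat list) set" where
  "plactic_relations n =
     {([x, z, y], [z, x, y]) | x y z. {x, y, z} \<subseteq> {1..n} \<and> x \<le> y \<and> y < z} \<union>
     {([y, x, z], [y, z, x]) | x y z. {x, y, z} \<subseteq> {1..n} \<and> x < y \<and> y \<le> z}"

definition plactic_monoid :: "nat \<Rightarrow> nat list set monoid" where
  "plactic_monoid n = presented_monoid {1..n} (plactic_relations n)"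

end

theory Submission
  imports Defs "HOL-Library.Nat_Bijection"
begin

text \<open>
  Generate the Plactic monoid by its columns, the subsets of \<open>{1..n}\<close>, the empty column being a
  redundant name for the identity. The product of two columns is the reading of a tableau with at
  most two columns, which gives an idempotent map \<open>N\<close> on pairs of columns. In terms of counting
  functions \<open>N\<close> is the Pitman transform, so on triples of columns it satisfies the braid relation
  \<open>N\<^sub>1 N\<^sub>2 N\<^sub>1 = N\<^sub>2 N\<^sub>1 N\<^sub>2\<close>.

  A finite presentation with relations \<open>a b = N(a, b)\<close> for such a map has finite derivation type, the
  braid relations being the essential 2-cells. Indeed, choose for every word a path to its normal
  form by multiplying letters from the left, one pass \<open>N\<^sub>1, N\<^sub>2, \<dots>\<close> for each letter. Up to homotopy
  this path does not change when an edge is put in front of it, by the 0-Hecke identity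
  \<open>(N\<^sub>2 \<cdots> N\<^sub>k) (N\<^sub>1 \<cdots> N\<^sub>k) = N\<^sub>1 (N\<^sub>2 \<cdots> N\<^sub>k) (N\<^sub>1 \<cdots> N\<^sub>k)\<close> (maps applied from left to right), and
  therefore any two parallel paths are homotopic.
\<close>

section \<open>Calculus of homotopic paths\<close>

definition act :: "'a list \<Rightarrow> 'a edge list \<Rightarrow> 'a list \<Rightarrow> 'a edge list" where
  "act x es y = map (\<lambda>e. edge_act x e y) es"

lemma act_simps [simp]:
  "act x [] y = []"
  "act x (e # es) y = edge_act x e y # act x es y"
  "act x (es @ fs) y = act x es y @ act x fs y"
  by (simp_all add: act_def)

lemma edge_act_act [simp]: "edge_act x (edge_act x' e y') y = edge_act (x @ x') e (y' @ y)"
  by (cases e) simp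

lemma act_act [simp]: "act x (act x' es y') y = act (x @ x') es (y' @ y)"
  by (induction es) auto

lemma edge_act_Nil [simp]: "edge_act [] e [] = e"
  by (cases e) simp

lemma act_Nil_Nil [simp]: "act [] es [] = es"
  by (induction es) auto

locale homotopy =
  fixes X :: "'a set" and S :: "('a list \<times> 'a list) set" and H :: "('a dpath \<times> 'a dpath) set"
  assumes pres: "presentation X S" and hrel: "homotopy_relation X S H"
begin

text \<open>The starting word is kept apart from the edge list, so that composition of paths becomes
  list append and the two-sided action becomes \<open>act\<close>.\<close>

definition deriv :: "'a list \<Rightarrow> 'a edge list \<Rightarrow> 'a list \<Rightarrow> bool" where
  "deriv w es w' \<longleftrightarrow> (w, es) \<in> paths X S \<and> path_tgt (w, es) = w'"

definition homot :: "'a list \<Rightarrow> 'a edge list \<Rightarrow> 'a edge list \<Rightarrow> bool" where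
  "homot w es fs \<longleftrightarrow> ((w, es), (w, fs)) \<in> H"

lemma deriv_Nil [simp]: "deriv w [] w' \<longleftrightarrow> w \<in> lists X \<and> w = w'"
  by (auto simp: deriv_def paths_def path_tgt_def)

lemma deriv_Cons [simp]:
  "deriv w (e # es) w' \<longleftrightarrow> e \<in> edges X S \<and> edge_src e = w \<and> deriv (edge_tgt e) es w'"
  using edge_src_in_lists[OF pres, of e] edge_tgt_in_lists[OF pres, of e]
  by (auto simp: deriv_def paths_def path_tgt_def)

lemma deriv_unique: "deriv w es u \<Longrightarrow> deriv w es v \<Longrightarrow> u = v"
  by (simp add: deriv_def)

lemma deriv_lists: "deriv w es w' \<Longrightarrow> w \<in> lists X \<and> w' \<in> lists X"
  using path_tgt_in_lists[OF pres] by (auto simp: deriv_def paths_def)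

lemma deriv_append [simp]:
  "deriv w (es @ fs) u \<longleftrightarrow> (\<exists>v. deriv w es v \<and> deriv v fs u)"
proof (induction es arbitrary: w)
  case Nil
  then show ?case using deriv_lists by (metis append_Nil deriv_Nil)
qed auto

lemma deriv_act:
  assumes "deriv w es w'" and "x \<in> lists X" and "y \<in> lists X"
  shows "deriv (x @ w @ y) (act x es y) (x @ w' @ y)"
proof -
  have "path_act x (w, es) y \<in> paths X S"
    using assms by (intro path_act_in_paths) (auto simp: deriv_def)
  moreover have "path_act x (w, es) y = (x @ w @ y, act x es y)"
    by (simp add: path_act_def act_def)
  ultimately show ?thesis
    using path_tgt_simps(2)[of x "(w, es)" y] assms by (simp add: deriv_def)
qed

lemma deriv_act_left:
  assumes "deriv w es w'" and "x \<in> lists X"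
  shows "deriv (x @ w) (act x es []) (x @ w')"
  using deriv_act[OF assms, of "[]"] by simp

lemma deriv_act_hd: "deriv w es w' \<Longrightarrow> a \<in> X \<Longrightarrow> deriv (a # w) (act [a] es []) (a # w')"
  using deriv_act_left[of w es w' "[a]"] by simp

lemma deriv_act_right:
  assumes "deriv w es w'" and "y \<in> lists X"
  shows "deriv (w @ y) (act [] es y) (w' @ y)"
  using deriv_act[OF assms(1) _ assms(2), of "[]"] by simp

lemma homot_deriv:
  assumes "homot w es fs"
  obtains w' where "deriv w es w'" "deriv w fs w'"
proof -
  have "((w, es), (w, fs)) \<in> parallelism X S"
    using assms hrel by (auto simp: homot_def homotopy_relation_def)
  then show ?thesis using that by (auto simp: parallelism_def deriv_def)
qed

lemma homot_deriv_iff: "homot w es fs \<Longrightarrow> deriv w es w' \<longleftrightarrow> deriv w fs w'"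
  by (elim homot_deriv) (auto simp: deriv_def)

lemma equivH: "equiv (paths X S) H"
  using hrel by (simp add: homotopy_relation_def)

lemma homot_refl: "deriv w es w' \<Longrightarrow> homot w es es"
  using equivH by (auto simp: homot_def deriv_def equiv_def refl_on_def)

lemma homot_sym: "homot w es fs \<Longrightarrow> homot w fs es"
  using equivH unfolding homot_def equiv_def by (meson symD)

lemma homot_trans [trans]: "homot w es fs \<Longrightarrow> homot w fs gs \<Longrightarrow> homot w es gs"
  using equivH unfolding homot_def equiv_def by (meson transD)

lemma homot_context:
  assumes "deriv v es w" and "homot w fs gs" and "deriv w fs w'" and "deriv w' es' w''"
  shows "homot v (es @ fs @ es') (es @ gs @ es')"
proof -
  have "((v, es) \<cdot> (w, fs) \<cdot> (w', es'), (v, es) \<cdot> (w, gs) \<cdot> (w', es')) \<in> H"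
    using hrel assms unfolding homotopy_relation_def homot_def deriv_def path_src_def
    by (metis fst_conv)
  then show ?thesis by (simp add: homot_def path_comp_def)
qed

lemma homot_append_left:
  assumes "deriv v es w" and "homot w fs gs"
  shows "homot v (es @ fs) (es @ gs)"
proof -
  obtain w' where w': "deriv w fs w'" using assms(2) homot_deriv by blast
  then have "deriv w' [] w'" using deriv_lists by simp
  from homot_context[OF assms w' this] show ?thesis by simp
qed

lemma homot_append_right:
  assumes "homot w fs gs" and "deriv w fs w'" and "deriv w' es w''"
  shows "homot w (fs @ es) (gs @ es)"
proof -
  have "deriv w [] w" using assms(2) deriv_lists by simp
  from homot_context[OF this assms] show ?thesis by simp
qed

lemma homot_append_right_deriv:
  assumes "homot w fs gs" and "deriv w (fs @ es) w'"
  shows "homot w (fs @ es) (gs @ es)"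
proof -
  obtain v where "deriv w fs v" "deriv v es w'" using assms(2) by auto
  with assms(1) show ?thesis by (rule homot_append_right)
qed

lemma homot_Cons:
  assumes "e \<in> edges X S" and "edge_src e = w" and "homot (edge_tgt e) fs gs"
  shows "homot w (e # fs) (e # gs)"
proof -
  have "deriv w [e] (edge_tgt e)"
    using assms edge_tgt_in_lists[OF pres] by simp
  from homot_append_left[OF this assms(3)] show ?thesis by simp
qed

lemma homot_act:
  assumes "homot w es fs" and "x \<in> lists X" and "y \<in> lists X"
  shows "homot (x @ w @ y) (act x es y) (act x fs y)"
proof -
  have "(path_act x (w, es) y, path_act x (w, fs) y) \<in> H"
    using hrel assms unfolding homotopy_relation_def homot_def by blast
  then show ?thesis by (simp add: homot_def path_act_def act_def)
qed

lemma homot_act_hd: "homot w es fs \<Longrightarrow> a \<in> X \<Longrightarrow> homot (a # w) (act [a] es []) (act [a] fs [])"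
  using homot_act[of w es fs "[a]" "[]"] by simp

lemma homot_act_right: "homot w es fs \<Longrightarrow> y \<in> lists X \<Longrightarrow> homot (w @ y) (act [] es y) (act [] fs y)"
  using homot_act[of w es fs "[]" y] by simp

lemma homot_inv_right:
  assumes "e \<in> edges X S" and "edge_src e = w"
  shows "homot w [e, edge_inv e] []"
proof -
  have "(edge_path e \<cdot> path_inv (edge_path e), empty_path (path_src (edge_path e))) \<in> H"
    using hrel edge_path_in_paths[OF pres assms(1)] unfolding homotopy_relation_def by blast
  then show ?thesis
    using assms(2) by (simp add: homot_def path_inv_def edge_path_def path_comp_def empty_path_def
        path_src_def)
qed

lemma homot_append_inv:
  assumes "deriv w es w'"
  shows "homot w (es @ rev (map edge_inv es)) []"
proof -
  have "((w, es) \<cdot> path_inv (w, es), empty_path (path_src (w, es))) \<in> H"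
    using hrel assms unfolding homotopy_relation_def deriv_def by blast
  then show ?thesis
    by (simp add: homot_def path_inv_def path_comp_def empty_path_def path_src_def)
qed

section \<open>Interchange of paths acting on disjoint parts of a word\<close>

lemma interchange_edges:
  assumes "e \<in> edges X S" and "f \<in> edges X S"
  shows "homot (edge_src e @ edge_src f)
    [edge_act [] e (edge_src f), edge_act (edge_tgt e) f []]
    [edge_act (edge_src e) f [], edge_act [] e (edge_tgt f)]"
proof -
  have "(path_act [] (edge_path e) (edge_src f) \<cdot> path_act (edge_tgt e) (edge_path f) [],
      path_act (edge_src e) (edge_path f) [] \<cdot> path_act [] (edge_path e) (edge_tgt f)) \<in> H"
    using hrel assms unfolding homotopy_relation_def by blast
  then show ?thesis
    by (simp add: homot_def path_act_def edge_path_def path_comp_def)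
qed

lemma interchange_edge_path:
  assumes "e \<in> edges X S" and "deriv v fs v'"
  shows "homot (edge_src e @ v)
    (edge_act [] e v # act (edge_tgt e) fs [])
    (act (edge_src e) fs [] @ [edge_act [] e v'])"
  using assms(2)
proof (induction fs arbitrary: v)
  case Nil
  then show ?case
    using assms(1) by (auto intro!: homot_refl[of _ _ "edge_tgt e @ v'"] edge_act_in_edges
      edge_tgt_in_lists[OF pres] simp del: in_lists_conv_set simp: append_in_lists_conv)
next
  case (Cons f fs)
  let ?s = "edge_src e" and ?t = "edge_tgt e"
  have s: "?s \<in> lists X" and t: "?t \<in> lists X"
    using assms(1) edge_src_in_lists[OF pres] edge_tgt_in_lists[OF pres] by blast+
  have f: "f \<in> edges X S" "edge_src f = v" "deriv (edge_tgt f) fs v'"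
    using Cons.prems by auto
  have v: "v \<in> lists X" "edge_tgt f \<in> lists X"
    using f edge_src_in_lists[OF pres] edge_tgt_in_lists[OF pres] by blast+
  have "homot (?s @ v) ([edge_act [] e v, edge_act ?t f []] @ act ?t fs [])
      ([edge_act ?s f [], edge_act [] e (edge_tgt f)] @ act ?t fs [])"
  proof (rule homot_append_right)
    show "homot (?s @ v) [edge_act [] e v, edge_act ?t f []]
      [edge_act ?s f [], edge_act [] e (edge_tgt f)]"
      using interchange_edges[OF assms(1) f(1)] f(2) by simp
    show "deriv (?s @ v) [edge_act [] e v, edge_act ?t f []] (?t @ edge_tgt f)"
      using f v t assms(1) by (auto intro!: edge_act_in_edges
          simp del: in_lists_conv_set simp: append_in_lists_conv)
    show "deriv (?t @ edge_tgt f) (act ?t fs []) (?t @ v')"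
      using f t by (intro deriv_act_left)
  qed
  moreover have "homot (?s @ v) (edge_act ?s f [] # (edge_act [] e (edge_tgt f) # act ?t fs []))
      (edge_act ?s f [] # (act ?s fs [] @ [edge_act [] e v']))"
    using Cons.IH[OF f(3)] f s by (intro homot_Cons) (auto intro: edge_act_in_edges)
  ultimately show ?case by (auto intro: homot_trans)
qed

text \<open>Condition (a) concerns two single edges. \<open>interchange_edge_path\<close> moves one
  edge past all of \<open>fs\<close>; here the edges of \<open>es\<close> are moved one after the
  other, the last one first.\<close>

lemma interchange:
  assumes "deriv w es w'" and "deriv v fs v'"
  shows "homot (w @ v) (act [] es v @ act w' fs []) (act w fs [] @ act [] es v')"
  using assms(1)
proof (induction es arbitrary: w)
  case Nil
  then show ?case
    using deriv_act_left[OF assms(2), of w] by (auto intro: homot_refl)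
next
  case (Cons e es)
  then have e: "e \<in> edges X S" "edge_src e = w" "deriv (edge_tgt e) es w'" by auto
  note v = deriv_lists[OF assms(2)] and t = deriv_lists[OF e(3)]
  have w: "w \<in> lists X" using edge_src_in_lists[OF pres e(1)] e(2) by simp
  have "homot (w @ v) (edge_act [] e v # (act [] es v @ act w' fs []))
      (edge_act [] e v # (act (edge_tgt e) fs [] @ act [] es v'))"
    using Cons.IH[OF e(3)] e v by (intro homot_Cons) (auto intro!: edge_act_in_edges)
  moreover have "homot (w @ v) ((edge_act [] e v # act (edge_tgt e) fs []) @ act [] es v')
      ((act w fs [] @ [edge_act [] e v']) @ act [] es v')"
  proof (rule homot_append_right)
    show "homot (w @ v) (edge_act [] e v # act (edge_tgt e) fs []) (act w fs [] @ [edge_act [] e v'])"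
      using interchange_edge_path[OF e(1) assms(2)] e(2) by simp
    show "deriv (w @ v) (edge_act [] e v # act (edge_tgt e) fs []) (edge_tgt e @ v')"
      using e v deriv_act_left[OF assms(2)] t by (auto intro!: edge_act_in_edges)
    show "deriv (edge_tgt e @ v') (act [] es v') (w' @ v')"
      using e v by (intro deriv_act_right) auto
  qed
  ultimately show ?case by (auto intro: homot_trans)
qed

text \<open>The paths \<open>q w\<close> act like a contraction. Compatibility with positive edges
  passes to inverse edges by cancellation and to all paths by induction. Hence a path from
  \<open>w\<close> to \<open>w'\<close> is homotopic to \<open>q w\<close> followed by the inverse
  of \<open>q w'\<close>, which depends on its ends alone.\<close>

lemma parallelism_if_coherent:
  assumes q: "\<And>w. w \<in> lists X \<Longrightarrow> deriv w (q w) (G w)"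
    and coh: "\<And>u s v. u \<in> lists X \<Longrightarrow> s \<in> S \<Longrightarrow> v \<in> lists X \<Longrightarrow>
      homot (u @ fst s @ v) (q (u @ fst s @ v)) ((u, s, True, v) # q (u @ snd s @ v))"
  shows "H = parallelism X S"
proof
  show "H \<subseteq> parallelism X S" using hrel by (simp add: homotopy_relation_def)
  have edge: "homot (edge_src e) (q (edge_src e)) (e # q (edge_tgt e))" if "e \<in> edges X S" for e
  proof -
    obtain u lhs rhs b v where e: "e = (u, (lhs, rhs), b, v)" by (cases e) auto
    have c: "homot (u @ lhs @ v) (q (u @ lhs @ v)) ((u, (lhs, rhs), True, v) # q (u @ rhs @ v))"
      using coh[of u "(lhs, rhs)" v] that by (auto simp: e edges_def)
    show ?thesis
    proof (cases b)
      case True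
      with c show ?thesis by (simp add: e)
    next
      case False
      let ?d = "(u, (lhs, rhs), True, v)"
      have d: "e \<in> edges X S" "edge_inv e = ?d" "edge_src e = u @ rhs @ v" "edge_tgt e = u @ lhs @ v"
        using that False by (auto simp: e)
      \<comment> \<open>For a negative edge the hypothesis is applied to its positive inverse
        \<open>?d\<close>; then \<open>e\<close> and \<open>?d\<close> cancel.\<close>
      have "homot (edge_src e) (e # q (edge_tgt e)) (e # ?d # q (edge_src e))"
        using c d by (intro homot_Cons) auto
      moreover have "homot (edge_src e) ([e, ?d] @ q (edge_src e)) ([] @ q (edge_src e))"
      proof (rule homot_append_right)
        show "homot (edge_src e) [e, ?d] []" using homot_inv_right[OF d(1)] d(2) by simp
        have "edge_src e \<in> lists X" using edge_src_in_lists[OF pres d(1)] .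
        then show "deriv (edge_src e) [e, ?d] (edge_src e)" 
          and "deriv (edge_src e) (q (edge_src e)) (G (edge_src e))"
          using d edge_inv_in_edges[OF d(1)] q by (auto simp: e False)
      qed
      ultimately show ?thesis by (auto intro: homot_trans homot_sym)
    qed
  qed
  have path: "homot w (q w) (es @ q w')" if "deriv w es w'" for w es w'
    using that
  proof (induction es arbitrary: w)
    case Nil
    then show ?case using q by (auto intro: homot_refl)
  next
    case (Cons e es)
    then have e: "e \<in> edges X S" "edge_src e = w" "deriv (edge_tgt e) es w'" by auto
    have "homot w (q w) (e # q (edge_tgt e))" using edge[OF e(1)] e(2) by simp
    also have "homot w (e # q (edge_tgt e)) (e # (es @ q w'))"
      using Cons.IH[OF e(3)] e by (intro homot_Cons) auto
    finally (homot_trans) show ?case by simp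
  qed
  show "parallelism X S \<subseteq> H"
  proof (clarify)
    fix w es v fs
    assume a: "((w, es), (v, fs)) \<in> parallelism X S"
    define w' where "w' = path_tgt (w, es)"
    from a have v: "v = w" and es: "deriv w es w'" and fs: "deriv w fs w'"
      by (auto simp: parallelism_def deriv_def path_src_def w'_def)
    let ?q = "rev (map edge_inv (q w'))"
    have w': "w' \<in> lists X" using deriv_lists[OF es] by simp
    have qq: "homot w' (q w' @ ?q) []" using homot_append_inv[OF q[OF w']] .
    then obtain w'' where "deriv w' (q w' @ ?q) w''" by (auto elim: homot_deriv)
    with q[OF w'] have inv: "deriv (G w') ?q w''" by (auto dest: deriv_unique)
    \<comment> \<open>Append the null-homotopic loop \<open>q w' @ ?q\<close> to \<open>gs\<close>;
      by \<open>path\<close> the part \<open>gs @ q w'\<close> becomes \<open>q w\<close>, and the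
      result no longer mentions \<open>gs\<close>.\<close>
    have *: "homot w gs (q w @ ?q)" if "deriv w gs w'" for gs
    proof -
      have "homot w (gs @ []) (gs @ (q w' @ ?q))"
        using homot_append_left[OF that homot_sym[OF qq]] .
      moreover have "homot w ((gs @ q w') @ ?q) (q w @ ?q)"
      proof (rule homot_append_right)
        show "homot w (gs @ q w') (q w)" using path[OF that] by (rule homot_sym)
        show "deriv w (gs @ q w') (G w')" using that q[OF w'] by auto
      qed (rule inv)
      ultimately show ?thesis by (auto intro: homot_trans)
    qed
    show "((w, es), (v, fs)) \<in> H"
      using homot_trans[OF *[OF es] homot_sym[OF *[OF fs]]] by (simp add: homot_def v)
  qed
qed

end

section \<open>Presentations by braided idempotent maps\<close>

text \<open>\<open>l\<close> and \<open>r\<close> are the components of the map \<open>N\<close>;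
  \<open>braid1\<close>, \<open>braid2\<close>, \<open>braid3\<close> compare the three letters of
  \<open>N\<^sub>1 N\<^sub>2 N\<^sub>1\<close> and \<open>N\<^sub>2 N\<^sub>1 N\<^sub>2\<close> at
  \<open>(a, b, c)\<close>. Since \<open>N(e, b) = (b, e)\<close> and
  \<open>N(a, e) = (a, e)\<close>, the unit letter travels to the right.\<close>

locale braided_idempotent =
  fixes X :: "'a set" and l r :: "'a \<Rightarrow> 'a \<Rightarrow> 'a" and e :: 'a
  assumes finite_X: "finite X"
    and l_closed: "a \<in> X \<Longrightarrow> b \<in> X \<Longrightarrow> l a b \<in> X"
    and r_closed: "a \<in> X \<Longrightarrow> b \<in> X \<Longrightarrow> r a b \<in> X"
    and l_idem: "a \<in> X \<Longrightarrow> b \<in> X \<Longrightarrow> l (l a b) (r a b) = l a b"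
    and r_idem: "a \<in> X \<Longrightarrow> b \<in> X \<Longrightarrow> r (l a b) (r a b) = r a b"
    and braid1: "a \<in> X \<Longrightarrow> b \<in> X \<Longrightarrow> c \<in> X \<Longrightarrow>
      l (l a b) (l (r a b) c) = l a (l b c)"
    and braid2: "a \<in> X \<Longrightarrow> b \<in> X \<Longrightarrow> c \<in> X \<Longrightarrow>
      r (l a b) (l (r a b) c) = l (r a (l b c)) (r b c)"
    and braid3: "a \<in> X \<Longrightarrow> b \<in> X \<Longrightarrow> c \<in> X \<Longrightarrow>
      r (r a b) c = r (r a (l b c)) (r b c)"
    and unit_in: "e \<in> X"
    and unit_left: "b \<in> X \<Longrightarrow> l e b = b" "b \<in> X \<Longrightarrow> r e b = e"
    and unit_right: "a \<in> X \<Longrightarrow> l a e = a" "a \<in> X \<Longrightarrow> r a e = e"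
begin

section \<open>The presentation and its generating 2-cells\<close>

definition swap_rel :: "'a \<Rightarrow> 'a \<Rightarrow> 'a list \<times> 'a list" where
  "swap_rel a b = ([a, b], [l a b, r a b])"

definition rels :: "('a list \<times> 'a list) set" where
  "rels = insert ([e], []) ((\<lambda>(a, b). swap_rel a b) ` (X \<times> X))"

definition swap_edge :: "'a list \<Rightarrow> 'a \<Rightarrow> 'a \<Rightarrow> 'a list \<Rightarrow> 'a edge" where
  "swap_edge u a b v = (u, swap_rel a b, True, v)"

definition unit_edge :: "'a list \<Rightarrow> 'a list \<Rightarrow> 'a edge" where
  "unit_edge u v = (u, ([e], []), True, v)"

definition braid_cell :: "'a \<Rightarrow> 'a \<Rightarrow> 'a \<Rightarrow> 'a dpath \<times> 'a dpath" where
  "braid_cell a b c =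
    (([a, b, c], [swap_edge [] a b [c], swap_edge [l a b] (r a b) c [],
       swap_edge [] (l a b) (l (r a b) c) [r (r a b) c]]),
     ([a, b, c], [swap_edge [a] b c [], swap_edge [] a (l b c) [r b c],
       swap_edge [l a (l b c)] (r a (l b c)) (r b c) []]))"

text \<open>\<open>N\<close> fixes every pair in its image, so the relation at such a pair is
  trivial and its edge is a loop; this cell contracts the loop.\<close>

definition idem_cell :: "'a \<Rightarrow> 'a \<Rightarrow> 'a dpath \<times> 'a dpath" where
  "idem_cell a b =
    (([l a b, r a b], [swap_edge [] (l a b) (r a b) []]), ([l a b, r a b], []))"

text \<open>The deletion of a unit and its swap with \<open>b\<close> start at the same word; this
  cell closes that overlap.\<close>

definition unit_cell :: "'a \<Rightarrow> 'a dpath \<times> 'a dpath" where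
  "unit_cell b =
    (([e, b], [swap_edge [] e b [], unit_edge [b] []]), ([e, b], [unit_edge [] [b]]))"

definition cells :: "('a dpath \<times> 'a dpath) set" where
  "cells = (\<lambda>(a, b, c). braid_cell a b c) ` (X \<times> X \<times> X) \<union>
    (\<lambda>(a, b). idem_cell a b) ` (X \<times> X) \<union> unit_cell ` X"

lemma edge_simps [simp]:
  "edge_src (swap_edge u a b v) = u @ a # b # v"
  "edge_tgt (swap_edge u a b v) = u @ l a b # r a b # v"
  "edge_act x (swap_edge u a b v) y = swap_edge (x @ u) a b (v @ y)"
  "edge_src (unit_edge u v) = u @ e # v"
  "edge_tgt (unit_edge u v) = u @ v"
  "edge_act x (unit_edge u v) y = unit_edge (x @ u) (v @ y)"
  by (simp_all add: swap_edge_def swap_rel_def unit_edge_def)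

lemma edges_simps [simp]:
  "swap_edge u a b v \<in> edges X rels \<longleftrightarrow> u \<in> lists X \<and> v \<in> lists X \<and> swap_rel a b \<in> rels"
  "unit_edge u v \<in> edges X rels \<longleftrightarrow> u \<in> lists X \<and> v \<in> lists X"
  by (auto simp: edges_def rels_def swap_edge_def unit_edge_def)

lemma swap_rel_in [simp]: "a \<in> X \<Longrightarrow> b \<in> X \<Longrightarrow> swap_rel a b \<in> rels"
  by (auto simp: rels_def)

lemmas [simp] = l_closed r_closed unit_in unit_left unit_right

lemma presentation_rels: "presentation X rels"
  by (auto simp: presentation_def rels_def swap_rel_def)

lemma finite_presentation_rels: "finite_presentation X rels"
  using presentation_rels finite_X by (simp add: finite_presentation_def rels_def)

lemma cells_parallel: "cells \<subseteq> parallelism X rels"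
proof -
  have "braid_cell a b c \<in> parallelism X rels" if "a \<in> X" "b \<in> X" "c \<in> X" for a b c
    using that braid1[OF that] braid2[OF that] braid3[OF that]
    by (auto simp: parallelism_def braid_cell_def paths_def path_src_def path_tgt_def)
  moreover have "idem_cell a b \<in> parallelism X rels" if "a \<in> X" "b \<in> X" for a b
    using that l_idem[OF that] r_idem[OF that]
    by (auto simp: parallelism_def idem_cell_def paths_def path_src_def path_tgt_def)
  moreover have "unit_cell b \<in> parallelism X rels" if "b \<in> X" for b
    using that
    by (auto simp: parallelism_def unit_cell_def paths_def path_src_def path_tgt_def)
  ultimately show ?thesis by (auto simp: cells_def)
qed

lemma finite_cells: "finite cells"
  using finite_X by (simp add: cells_def)

section \<open>Passes, normal forms with units, deletion of units\<close>

text \<open>The word \<open>nf w\<close> is a normal form in which the units are still present; they end up on the right.\<close>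

fun passw :: "'a \<Rightarrow> 'a list \<Rightarrow> 'a list" where
  "passw a [] = [a]"
| "passw a (b # w) = l a b # passw (r a b) w"

fun pass :: "'a \<Rightarrow> 'a list \<Rightarrow> 'a edge list" where
  "pass a [] = []"
| "pass a (b # w) = swap_edge [] a b w # act [l a b] (pass (r a b) w) []"

fun nf :: "'a list \<Rightarrow> 'a list" where
  "nf [] = []"
| "nf (a # w) = passw a (nf w)"

fun norm :: "'a list \<Rightarrow> 'a edge list" where
  "norm [] = []"
| "norm (a # w) = act [a] (norm w) [] @ pass a (nf w)"

abbreviation strip :: "'a list \<Rightarrow> 'a list" where
  "strip w \<equiv> filter (\<lambda>a. a \<noteq> e) w"

text \<open>The deletions run from right to left, so a unit is removed in front of a tail from which
  the units are already gone.\<close>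

fun del :: "'a list \<Rightarrow> 'a edge list" where
  "del [] = []"
| "del (a # w) = act [a] (del w) [] @ (if a = e then [unit_edge [] (strip w)] else [])"

lemma passw_in: "a \<in> X \<Longrightarrow> w \<in> lists X \<Longrightarrow> passw a w \<in> lists X"
  by (induction w arbitrary: a) auto

lemma nf_in: "w \<in> lists X \<Longrightarrow> nf w \<in> lists X"
  by (induction w) (auto simp: passw_in simp del: in_lists_conv_set)

lemma passw_snoc: "a \<in> X \<Longrightarrow> w \<in> lists X \<Longrightarrow> passw a (w @ [e]) = passw a w @ [e]"
  by (induction w arbitrary: a) auto

lemma passw_unit: "w \<in> lists X \<Longrightarrow> passw e w = w @ [e]"
  by (induction w) auto

section \<open>Words in which \<open>N\<close> fixes all adjacent pairs\<close>

fun normal :: "'a list \<Rightarrow> bool" where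
  "normal (a # b # w) \<longleftrightarrow> l a b = a \<and> r a b = b \<and> normal (b # w)"
| "normal _ \<longleftrightarrow> True"

text \<open>If \<open>N\<close> fixes \<open>(b, c)\<close>, the braid relation at
  \<open>(a, b, c)\<close> becomes
  \<open>N\<^sub>1 N\<^sub>2 N\<^sub>1 = N\<^sub>1 N\<^sub>2\<close>, so the first two letters after
  \<open>N\<^sub>1 N\<^sub>2\<close> form a pair fixed by \<open>N\<close>.\<close>

lemma normal_Cons_passw:
  assumes "a \<in> X" "b \<in> X" "w \<in> lists X" "normal (b # w)"
  shows "normal (l a b # passw (r a b) w)"
  using assms
proof (induction w arbitrary: a b)
  case Nil
  then show ?case by (simp add: l_idem r_idem)
next
  case (Cons c w)
  then have in_X: "a \<in> X" "b \<in> X" "c \<in> X" by auto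
  have bc: "l b c = b" "r b c = c" using Cons.prems by auto
  have "normal (l (r a b) c # passw (r (r a b) c) w)"
    using Cons.IH[of "r a b" c] Cons.prems by simp
  moreover have "l (l a b) (l (r a b) c) = l a b" "r (l a b) (l (r a b) c) = l (r a b) c"
    using braid1[OF in_X] braid2[OF in_X] by (simp_all add: bc)
  ultimately show ?case by simp
qed

lemma normal_passw:
  assumes "a \<in> X" "w \<in> lists X" "normal w"
  shows "normal (passw a w)"
proof (cases w)
  case (Cons b v)
  then show ?thesis using normal_Cons_passw[of a b v] assms by simp
qed simp

lemma normal_nf: "w \<in> lists X \<Longrightarrow> normal (nf w)"
  by (induction w) (auto simp: normal_passw nf_in simp del: in_lists_conv_set)

text \<open>As \<open>l e a = a\<close> for every letter, a letter following the unit in a normal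
  word must itself be the unit.\<close>

lemma normal_unit:
  assumes "w \<in> lists X" "normal (e # w)"
  shows "\<forall>x\<in>set w. x = e"
  using assms
proof (induction w rule: list.induct)
  case (Cons a w)
  have "a \<in> X" "w \<in> lists X" using Cons.prems(1) by simp_all
  moreover have "l e a = e" "normal (a # w)" using Cons.prems(2) by (simp_all only: normal.simps)
  ultimately have "a = e" by (simp only: unit_left)
  moreover from this have "\<forall>x\<in>set w. x = e"
    using Cons.IH \<open>normal (a # w)\<close> \<open>w \<in> lists X\<close> by blast
  ultimately show ?case by (metis set_ConsD)
qed simp

lemma normal_strip:
  assumes "w \<in> lists X" "normal w"
  shows "\<exists>k. w = strip w @ replicate k e"
  using assms
proof (induction w rule: list.induct)
  case (Cons a w)
  show ?case
  proof (cases "a = e")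
    case True
    with Cons.prems normal_unit[of w] have w: "\<forall>x\<in>set w. x = e" by simp
    then have "strip w = []" by simp
    with True show ?thesis
      using replicate_length_same[OF w] by (intro exI[of _ "Suc (length w)"]) simp
  next
    case False
    have "normal w" using Cons.prems(2) by (cases w) auto
    with Cons False show ?thesis by auto
  qed
qed simp

end

section \<open>Homotopies obtained from the cells\<close>

locale braided_homotopy = braided_idempotent +
  fixes H
  assumes hrel_H: "homotopy_relation X rels H" and cells_H: "cells \<subseteq> H"
begin

sublocale homotopy X rels H
  using presentation_rels hrel_H by unfold_locales

lemma homot_braid:
  assumes "a \<in> X" "b \<in> X" "c \<in> X"
  shows "homot [a, b, c] [swap_edge [] a b [c], swap_edge [l a b] (r a b) c [],
       swap_edge [] (l a b) (l (r a b) c) [r (r a b) c]]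
      [swap_edge [a] b c [], swap_edge [] a (l b c) [r b c],
       swap_edge [l a (l b c)] (r a (l b c)) (r b c) []]"
proof -
  have "braid_cell a b c \<in> cells" unfolding cells_def using assms by force
  then show ?thesis using cells_H by (auto simp: homot_def braid_cell_def)
qed

lemma homot_idem:
  assumes "a \<in> X" "b \<in> X"
  shows "homot [l a b, r a b] [swap_edge [] (l a b) (r a b) []] []"
proof -
  have "idem_cell a b \<in> cells" unfolding cells_def using assms by force
  then show ?thesis using cells_H by (auto simp: homot_def idem_cell_def)
qed

lemma homot_unit:
  assumes "b \<in> X"
  shows "homot [e, b] [swap_edge [] e b [], unit_edge [b] []] [unit_edge [] [b]]"
proof -
  have "unit_cell b \<in> cells" unfolding cells_def using assms by force
  then show ?thesis using cells_H by (auto simp: homot_def unit_cell_def)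
qed

lemma deriv_pass: "a \<in> X \<Longrightarrow> w \<in> lists X \<Longrightarrow> deriv (a # w) (pass a w) (passw a w)"
proof (induction w arbitrary: a)
  case (Cons b w)
  then show ?case using deriv_act_hd[OF Cons.IH[of "r a b"], of "l a b"] by simp
qed simp

lemma deriv_norm: "w \<in> lists X \<Longrightarrow> deriv w (norm w) (nf w)"
proof (induction w)
  case (Cons a w)
  then have w: "a \<in> X" "w \<in> lists X" by auto
  show ?case
    using deriv_act_hd[OF Cons.IH[OF w(2)] w(1)] deriv_pass[OF w(1) nf_in[OF w(2)]] by auto
qed simp

lemma deriv_del: "w \<in> lists X \<Longrightarrow> deriv w (del w) (strip w)"
proof (induction w)
  case (Cons a w)
  then have w: "a \<in> X" "w \<in> lists X" by auto
  show ?case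
    using deriv_act_hd[OF Cons.IH[OF w(2)] w(1)] w by (auto intro!: exI[of _ "a # strip w"])
qed simp

lemma homot_interchange_pass:
  assumes "a \<in> X" "b \<in> X" "deriv w es w'"
  shows "homot (a # b # w) (act [a, b] es [] @ [swap_edge [] a b w'])
    (swap_edge [] a b w # act [l a b, r a b] es [])"
proof -
  have "deriv [a, b] [swap_edge [] a b []] [l a b, r a b]" using assms by simp
  from homot_sym[OF interchange[OF this assms(3)]] show ?thesis by simp
qed

text \<open>The letters to the right of the active ones are moved out of the way by interchange; what is left
  is one braid cell and the induction hypothesis for the tail, which comes with the two letters that
  the braid cell leaves behind.\<close>

lemma homot_pass_pass:
  assumes "a \<in> X" "b \<in> X" "w \<in> lists X"
  shows "homot (a # b # w) (act [a] (pass b w) [] @ pass a (passw b w))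
    (pass a (b # w) @ pass (l a b) (passw (r a b) w))"
  using assms
proof (induction w arbitrary: a b)
  case Nil
  have "homot [a, b] ([swap_edge [] a b []] @ [])
      ([swap_edge [] a b []] @ [swap_edge [] (l a b) (r a b) []])"
    using Nil homot_idem[of a b]
    by (intro homot_append_left[of _ _ "[l a b, r a b]"] homot_sym[OF homot_idem]) auto
  then show ?case by simp
next
  case (Cons c w)
  then have X: "a \<in> X" "b \<in> X" "c \<in> X" "w \<in> lists X" by auto
  \<comment> \<open>These letters arise from \<open>N\<^sub>2 N\<^sub>1 N\<^sub>2\<close> at
    \<open>(a, b, c)\<close>, with result \<open>(s, y, z)\<close>. The primed ones arise from
    \<open>N\<^sub>1 N\<^sub>2\<close>, with result \<open>(p', s', t')\<close>; by the braid
    relation a further \<open>N\<^sub>1\<close> gives \<open>(s, y, z)\<close> again.\<close>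
  define p q s t y z where "p = l b c" and "q = r b c" and "s = l a p" and "t = r a p"
    and "y = l t q" and "z = r t q"
  define p' q' s' t' where "p' = l a b" and "q' = r a b" and "s' = l q' c" and "t' = r q' c"
  note defs = p_def q_def s_def t_def y_def z_def p'_def q'_def s'_def t'_def
  have in_X: "p \<in> X" "q \<in> X" "s \<in> X" "t \<in> X" "y \<in> X" "z \<in> X" "p' \<in> X" "q' \<in> X" "s' \<in> X" "t' \<in> X"
    using X by (simp_all add: defs)
  have braid: "l p' s' = s" "r p' s' = y" "t' = z"
    using braid1[OF X(1-3)] braid2[OF X(1-3)] braid3[OF X(1-3)] by (simp_all add: defs)
  have tz: "r (r a b) c = z" using braid(3) by (simp add: t'_def q'_def)
  have lists: "passw q w \<in> lists X" "passw t' w \<in> lists X" "passw z w \<in> lists X"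
    using in_X X passw_in by blast+
  \<comment> \<open>Both sides will be brought to three swaps followed by this common path, which
    passes \<open>z\<close> and then \<open>y\<close> through the rest.\<close>
  let ?tail = "act [s, y] (pass z w) [] @ act [s] (pass y (passw z w)) []"
  \<comment> \<open>Left side: the swap of \<open>a\<close> and \<open>p\<close> happens in front of
    \<open>q\<close>, so it can precede the pass of \<open>q\<close> through
    \<open>w\<close>.\<close>
  have "homot (a # p # q # w) (act [a, p] (pass q w) [] @ [swap_edge [] a p (passw q w)])
      (swap_edge [] a p (q # w) # act [s, t] (pass q w) [])"
    using homot_interchange_pass[OF X(1) in_X(1) deriv_pass[OF in_X(2) X(4)]]
    by (simp add: s_def t_def)
  then have "homot (a # p # q # w)
      ((act [a, p] (pass q w) [] @ [swap_edge [] a p (passw q w)]) @ act [s] (pass t (passw q w)) [])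
      ((swap_edge [] a p (q # w) # act [s, t] (pass q w) []) @ act [s] (pass t (passw q w)) [])"
  proof (rule homot_append_right)
    show "deriv (a # p # q # w) (act [a, p] (pass q w) [] @ [swap_edge [] a p (passw q w)])
        (s # t # passw q w)"
      using deriv_act_left[OF deriv_pass[OF in_X(2) X(4)], of "[a, p]"] X in_X lists
      by (auto simp: s_def t_def intro!: exI[of _ "a # p # passw q w"])
    show "deriv (s # t # passw q w) (act [s] (pass t (passw q w)) []) (s # passw t (passw q w))"
      using in_X lists by (intro deriv_act_hd deriv_pass)
  qed
  \<comment> \<open>The induction hypothesis for \<open>t\<close>, \<open>q\<close>,
    \<open>w\<close> supplies the third swap, that of \<open>t\<close> and \<open>q\<close>, and
    leaves \<open>y\<close> and \<open>z\<close> to be passed.\<close>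
  moreover have "homot (a # p # q # w)
      (swap_edge [] a p (q # w) # act [s] (act [t] (pass q w) [] @ pass t (passw q w)) [])
      (swap_edge [] a p (q # w) # act [s] (pass t (q # w) @ pass y (passw z w)) [])"
    using X in_X homot_act_hd[OF Cons.IH[OF in_X(4,2) X(4)] in_X(3), folded y_def z_def]
    by (intro homot_Cons) (auto simp: s_def t_def)
  ultimately have "homot (a # p # q # w)
      (act [a, p] (pass q w) [] @ swap_edge [] a p (passw q w) # act [s] (pass t (passw q w)) [])
      (swap_edge [] a p (q # w) # swap_edge [s] t q w # ?tail)"
    by (auto simp: y_def z_def intro: homot_trans)
  then have left: "homot (a # b # c # w)
      (act [a] (pass b (c # w)) [] @ pass a (passw b (c # w)))
      (swap_edge [a] b c w # swap_edge [] a p (q # w) # swap_edge [s] t q w # ?tail)"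
    using X in_X homot_Cons[of "swap_edge [a] b c w"] by (simp add: p_def q_def s_def t_def)
  \<comment> \<open>Right side: the three swaps are already present, and interchange moves that of
    \<open>p'\<close> and \<open>s'\<close> before the pass of \<open>t'\<close>.\<close>
  have "homot (p' # s' # t' # w) (act [p', s'] (pass t' w) [] @ [swap_edge [] p' s' (passw t' w)])
      (swap_edge [] p' s' (t' # w) # act [s, y] (pass t' w) [])"
    using homot_interchange_pass[OF in_X(7,9) deriv_pass[OF in_X(10) X(4)]] by (simp add: braid)
  then have "homot (p' # s' # t' # w)
      ((act [p', s'] (pass t' w) [] @ [swap_edge [] p' s' (passw t' w)]) @
        act [s] (pass y (passw t' w)) [])
      ((swap_edge [] p' s' (t' # w) # act [s, y] (pass t' w) []) @
        act [s] (pass y (passw t' w)) [])"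
  proof (rule homot_append_right)
    show "deriv (p' # s' # t' # w)
        (act [p', s'] (pass t' w) [] @ [swap_edge [] p' s' (passw t' w)]) (s # y # passw t' w)"
      using deriv_act_left[OF deriv_pass[OF in_X(10) X(4)], of "[p', s']"] X in_X lists
      by (auto simp: braid(1,2) intro!: exI[of _ "p' # s' # passw t' w"])
    show "deriv (s # y # passw t' w) (act [s] (pass y (passw t' w)) []) (s # passw y (passw t' w))"
      using in_X lists by (intro deriv_act_hd deriv_pass)
  qed
  then have "homot (a # b # c # w) (swap_edge [] a b (c # w) # swap_edge [p'] q' c w #
      (act [p', s'] (pass t' w) [] @ swap_edge [] p' s' (passw t' w) # act [s] (pass y (passw t' w)) []))
     (swap_edge [] a b (c # w) # swap_edge [p'] q' c w # swap_edge [] p' s' (z # w) # ?tail)"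
    using X in_X
    by (intro homot_Cons) (auto simp: braid(3) p'_def q'_def s'_def tz)
  then have right: "homot (a # b # c # w)
      (pass a (b # c # w) @ pass (l a b) (passw (r a b) (c # w)))
      (swap_edge [] a b (c # w) # swap_edge [p'] q' c w # swap_edge [] p' s' (z # w) # ?tail)"
    using braid by (simp add: p'_def q'_def s'_def t'_def)
  \<comment> \<open>The braid cell, with \<open>w\<close> attached on the right, joins the two
    triples of swaps.\<close>
  have "homot ([a, b, c] @ w)
      (act [] [swap_edge [] a b [c], swap_edge [p'] q' c [], swap_edge [] p' s' [z]] w)
      (act [] [swap_edge [a] b c [], swap_edge [] a p [q], swap_edge [s] t q []] w)"
    using homot_act_right[OF homot_braid[OF X(1-3)] X(4)] braid(3) by (simp add: defs)
  then have "homot ([a, b, c] @ w)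
      (act [] [swap_edge [] a b [c], swap_edge [p'] q' c [], swap_edge [] p' s' [z]] w @ ?tail)
      (act [] [swap_edge [a] b c [], swap_edge [] a p [q], swap_edge [s] t q []] w @ ?tail)"
  proof (rule homot_append_right)
    show "deriv ([a, b, c] @ w)
        (act [] [swap_edge [] a b [c], swap_edge [p'] q' c [], swap_edge [] p' s' [z]] w)
        (s # y # z # w)"
      using X in_X braid by (auto simp: p'_def q'_def s'_def t'_def)
    show "deriv (s # y # z # w) ?tail (s # passw y (passw z w))"
      using deriv_act_left[OF deriv_pass[OF in_X(6) X(4)], of "[s, y]"]
        deriv_act_hd[OF deriv_pass[OF in_X(5) lists(3)] in_X(3)] in_X by auto
  qed
  then show ?case
    using homot_trans[OF left homot_sym] homot_trans[OF _ homot_sym[OF right]] by simp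
qed

text \<open>For empty \<open>u\<close>, the last two passes of \<open>norm\<close> can be preceded
  by the swap, by \<open>homot_pass_pass\<close>, and the swap then slides in front of the
  normalization of \<open>v\<close>. A further letter on the left adds the same pass on both
  sides.\<close>

lemma homot_norm_swap:
  assumes "u \<in> lists X" "a \<in> X" "b \<in> X" "v \<in> lists X"
  shows "homot (u @ a # b # v) (norm (u @ a # b # v))
    (swap_edge u a b v # norm (u @ l a b # r a b # v))"
  using assms(1)
proof (induction u rule: list.induct)
  case Nil
  let ?p = "l a b" and ?q = "r a b"
  have X: "?p \<in> X" "?q \<in> X" "nf v \<in> lists X" "passw b (nf v) \<in> lists X" "passw ?q (nf v) \<in> lists X"
    using assms passw_in nf_in by auto
  let ?tail = "act [?p] (pass ?q (nf v)) [] @ pass ?p (passw ?q (nf v))"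
  have tail: "deriv (?p # ?q # nf v) ?tail (passw ?p (passw ?q (nf v)))"
    using deriv_act_hd[OF deriv_pass[OF X(2,3)] X(1)] deriv_pass[OF X(1,5)] by auto
  have n: "deriv (a # b # v) (act [a, b] (norm v) []) (a # b # nf v)"
    using deriv_act_left[OF deriv_norm[OF assms(4)], of "[a, b]"] assms by simp
  have "homot (a # b # v)
      (act [a, b] (norm v) [] @ (act [a] (pass b (nf v)) [] @ pass a (passw b (nf v))))
      (act [a, b] (norm v) [] @ (swap_edge [] a b (nf v) # ?tail))"
    using homot_append_left[OF n homot_pass_pass[OF assms(2,3) X(3)]] by simp
  moreover have "homot (a # b # v)
      ((act [a, b] (norm v) [] @ [swap_edge [] a b (nf v)]) @ ?tail)
      ((swap_edge [] a b v # act [?p, ?q] (norm v) []) @ ?tail)"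
  proof (rule homot_append_right)
    show "homot (a # b # v) (act [a, b] (norm v) [] @ [swap_edge [] a b (nf v)])
        (swap_edge [] a b v # act [?p, ?q] (norm v) [])"
      using homot_interchange_pass[OF assms(2,3) deriv_norm[OF assms(4)]] .
    show "deriv (a # b # v) (act [a, b] (norm v) [] @ [swap_edge [] a b (nf v)]) (?p # ?q # nf v)"
      using n X assms by (auto intro!: exI[of _ "a # b # nf v"])
  qed (rule tail)
  ultimately show ?case by (auto intro: homot_trans)
next
  case (Cons x u)
  let ?w = "u @ a # b # v" and ?w' = "u @ l a b # r a b # v"
  have X: "x \<in> X" "u \<in> lists X" using Cons by auto
  have w: "?w \<in> lists X" "?w' \<in> lists X" using X assms by auto
  note IH = Cons.IH[OF X(2)]
  \<comment> \<open>Homotopic paths have the same end, which yields equality of the normal forms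
    without computing them.\<close>
  have "deriv ?w (norm ?w) (nf ?w')"
    unfolding homot_deriv_iff[OF IH] using X assms deriv_norm[OF w(2)] by simp
  from deriv_unique[OF deriv_norm[OF w(1)] this] have nf: "nf ?w = nf ?w'" .
  have "homot (x # ?w) (act [x] (norm ?w) [] @ pass x (nf ?w))
      (act [x] (swap_edge u a b v # norm ?w') [] @ pass x (nf ?w))"
  proof (rule homot_append_right)
    show "homot (x # ?w) (act [x] (norm ?w) []) (act [x] (swap_edge u a b v # norm ?w') [])"
      by (rule homot_act_hd[OF IH X(1)])
    show "deriv (x # ?w) (act [x] (norm ?w) []) (x # nf ?w)"
      by (rule deriv_act_hd[OF deriv_norm[OF w(1)] X(1)])
    show "deriv (x # nf ?w) (pass x (nf ?w)) (passw x (nf ?w))"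
      by (rule deriv_pass[OF X(1) nf_in[OF w(1)]])
  qed
  then show ?case by (simp add: nf)
qed

section \<open>Passes in the presence of units\<close>

lemma homot_pass_unit:
  assumes "w \<in> lists X"
  shows "homot (e # w) (pass e w @ del (w @ [e])) (unit_edge [] w # del w)"
  using assms
proof (induction w rule: list.induct)
  case Nil
  show ?case by (auto intro!: homot_refl[of _ _ "[]"])
next
  case (Cons b w)
  then have X: "b \<in> X" "w \<in> lists X" by auto
  let ?E = "if b = e then [unit_edge [] (strip w)] else []"
  have "deriv (b # e # w) (act [b] (pass e w @ del (w @ [e])) [] @ ?E) (strip (b # w))"
    using deriv_act_hd[OF deriv_pass[OF unit_in X(2)] X(1)]
      deriv_act_hd[OF deriv_del[of "w @ [e]"] X(1)] X by (auto simp: passw_unit)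
  with homot_act_hd[OF Cons.IH[OF X(2)] X(1)]
  have "homot (b # e # w) (act [b] (pass e w @ del (w @ [e])) [] @ ?E)
      (act [b] (unit_edge [] w # del w) [] @ ?E)"
    by (rule homot_append_right_deriv)
  then have "homot (e # b # w)
      (swap_edge [] e b w # (act [b] (pass e w @ del (w @ [e])) [] @ ?E))
      (swap_edge [] e b w # (act [b] (unit_edge [] w # del w) [] @ ?E))"
    using X by (intro homot_Cons) auto
  \<comment> \<open>The unit cell, with \<open>w\<close> attached, replaces the swap with
    \<open>b\<close> and the deletion after it by one deletion on the left.\<close>
  moreover have "homot (e # b # w)
      ([swap_edge [] e b w, unit_edge [b] w] @ del (b # w)) ([unit_edge [] (b # w)] @ del (b # w))"
  proof (rule homot_append_right_deriv)
    show "homot (e # b # w) [swap_edge [] e b w, unit_edge [b] w] [unit_edge [] (b # w)]"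
      using homot_act_right[OF homot_unit[OF X(1)] X(2)] by simp
    show "deriv (e # b # w) ([swap_edge [] e b w, unit_edge [b] w] @ del (b # w)) (strip (b # w))"
      using deriv_del[of "b # w"] X by (auto simp del: del.simps)
  qed
  ultimately show ?case using unit_left[OF X(1)] by (auto intro: homot_trans)
qed

text \<open>The last swap of the pass meets a pair \<open>(x, e)\<close>, which \<open>N\<close>
  fixes, so its loop is contracted; what remains is the pass over \<open>w\<close> beside an idle
  \<open>e\<close>.\<close>

lemma homot_pass_snoc:
  assumes "a \<in> X" "w \<in> lists X"
  shows "homot (a # w @ [e]) (pass a (w @ [e])) (act [] (pass a w) [e])"
  using assms(2,1)
proof (induction w arbitrary: a rule: list.induct)
  case Nil
  then show ?case using homot_idem[of a e] by simp
next
  case (Cons b w)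
  then have X: "a \<in> X" "b \<in> X" "w \<in> lists X" by auto
  have "homot (a # b # w @ [e]) (swap_edge [] a b (w @ [e]) # act [l a b] (pass (r a b) (w @ [e])) [])
      (swap_edge [] a b (w @ [e]) # act [l a b] (act [] (pass (r a b) w) [e]) [])"
    using X homot_act_hd[OF Cons.IH[OF X(3)], of "r a b" "l a b"] by (intro homot_Cons) auto
  then show ?case by simp
qed

lemma homot_del_snoc:
  assumes "w \<in> lists X"
  shows "homot (w @ [e]) (del (w @ [e])) (unit_edge w [] # del w)"
  using assms
proof (induction w rule: list.induct)
  case Nil
  show ?case by (auto intro!: homot_refl[of _ _ "[]"])
next
  case (Cons a w)
  then have X: "a \<in> X" "w \<in> lists X" by auto
  let ?E = "if a = e then [unit_edge [] (strip w)] else []"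
  have "deriv (a # w @ [e]) (act [a] (del (w @ [e])) [] @ ?E) (strip (a # w))"
    using deriv_act_hd[OF deriv_del[of "w @ [e]"] X(1)] X by auto
  with homot_act_hd[OF Cons.IH[OF X(2)] X(1)]
  have "homot (a # w @ [e]) (act [a] (del (w @ [e])) [] @ ?E)
      (act [a] (unit_edge w [] # del w) [] @ ?E)"
    by (rule homot_append_right_deriv)
  then show ?case by (cases "a = e") simp_all
qed

lemma deriv_pass_del:
  assumes "a \<in> X" "w \<in> lists X"
  shows "deriv (a # w) (pass a w @ del (passw a w)) (strip (passw a w))"
  using deriv_pass[OF assms] deriv_del[OF passw_in[OF assms]] by auto

text \<open>A trailing unit can be deleted before the pass: the pass leaves it idle,
  \<open>del\<close> removes it first, and interchange brings this deletion in front of the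
  pass.\<close>

lemma homot_pass_del_snoc:
  assumes "a \<in> X" "w \<in> lists X"
  shows "homot (a # w @ [e]) (pass a (w @ [e]) @ del (passw a (w @ [e])))
    (unit_edge (a # w) [] # pass a w @ del (passw a w))"
proof -
  have p: "passw a w \<in> lists X" using assms passw_in by blast
  have d: "deriv (a # w @ [e]) (pass a (w @ [e]) @ del (passw a (w @ [e]))) (strip (passw a w))"
    using deriv_pass_del[OF assms(1), of "w @ [e]"] assms by (simp add: passw_snoc)
  have 1: "homot (a # w @ [e]) (pass a (w @ [e]) @ del (passw a (w @ [e])))
      (act [] (pass a w) [e] @ del (passw a (w @ [e])))"
    by (rule homot_append_right_deriv[OF homot_pass_snoc[OF assms] d])
  have f: "deriv (a # w @ [e]) (act [] (pass a w) [e]) (passw a w @ [e])"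
    using deriv_act_right[OF deriv_pass[OF assms], of "[e]"] by simp
  have 2: "homot (a # w @ [e]) (act [] (pass a w) [e] @ del (passw a (w @ [e])))
      (act [] (pass a w) [e] @ (unit_edge (passw a w) [] # del (passw a w)))"
    using homot_append_left[OF f homot_del_snoc[OF p]] assms by (simp add: passw_snoc)
  have "deriv [e] [unit_edge [] []] []" by simp
  from interchange[OF deriv_pass[OF assms] this]
  have "homot (a # w @ [e]) (act [] (pass a w) [e] @ [unit_edge (passw a w) []])
      (unit_edge (a # w) [] # pass a w)" by simp
  moreover have "deriv (a # w @ [e])
      ((act [] (pass a w) [e] @ [unit_edge (passw a w) []]) @ del (passw a w)) (strip (passw a w))"
    using f p deriv_del[OF p] by auto
  ultimately have "homot (a # w @ [e])
      ((act [] (pass a w) [e] @ [unit_edge (passw a w) []]) @ del (passw a w))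
      ((unit_edge (a # w) [] # pass a w) @ del (passw a w))"
    by (rule homot_append_right_deriv)
  with homot_trans[OF 1 2] show ?thesis by (auto intro: homot_trans)
qed

lemma del_strip: "del (strip w) = []"
  by (induction w) auto

text \<open>The trailing units are removed one at a time. By \<open>normal_strip\<close> every
  normal word has the shape treated here.\<close>

lemma homot_pass_del_replicate:
  assumes "a \<in> X" "w \<in> lists X"
  shows "homot (a # strip w @ replicate k e)
    (pass a (strip w @ replicate k e) @ del (passw a (strip w @ replicate k e)))
    (act [a] (del (strip w @ replicate k e)) [] @ pass a (strip w) @ del (passw a (strip w)))"
proof (induction k)
  case 0
  have "strip w \<in> lists X" using assms by auto
  from homot_refl[OF deriv_pass_del[OF assms(1) this]] show ?case by (simp add: del_strip)
next
  case (Suc k)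
  let ?v = "strip w @ replicate k e" and ?T = "pass a (strip w) @ del (passw a (strip w))"
  have v: "?v \<in> lists X" using assms by auto
  have z: "strip w \<in> lists X" using assms by auto
  have "homot (a # ?v @ [e]) (pass a (?v @ [e]) @ del (passw a (?v @ [e])))
      (unit_edge (a # ?v) [] # (pass a ?v @ del (passw a ?v)))"
    by (rule homot_pass_del_snoc[OF assms(1) v])
  moreover have "homot (a # ?v @ [e]) (unit_edge (a # ?v) [] # (pass a ?v @ del (passw a ?v)))
      (unit_edge (a # ?v) [] # (act [a] (del ?v) [] @ ?T))"
    using Suc assms v by (intro homot_Cons) auto
  moreover have "homot (a # ?v @ [e]) (act [a] (unit_edge ?v [] # del ?v) [] @ ?T)
      (act [a] (del (?v @ [e])) [] @ ?T)"
  proof (rule homot_append_right_deriv)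
    show "homot (a # ?v @ [e]) (act [a] (unit_edge ?v [] # del ?v) []) (act [a] (del (?v @ [e])) [])"
      using homot_act_hd[OF homot_sym[OF homot_del_snoc[OF v]] assms(1)] .
    show "deriv (a # ?v @ [e]) (act [a] (unit_edge ?v [] # del ?v) [] @ ?T)
        (strip (passw a (strip w)))"
      using deriv_act_hd[OF deriv_del[OF v] assms(1)] deriv_pass_del[OF assms(1) z] assms v
      by auto
  qed
  ultimately have "homot (a # ?v @ [e]) (pass a (?v @ [e]) @ del (passw a (?v @ [e])))
      (act [a] (del (?v @ [e])) [] @ ?T)"
    by (auto intro: homot_trans)
  then show ?case by (simp add: replicate_append_same[symmetric] del: replicate_append_same)
qed

section \<open>Canonical paths to normal forms without units\<close>

definition canon :: "'a list \<Rightarrow> 'a edge list" where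
  "canon w = norm w @ del (nf w)"

lemma deriv_canon: "w \<in> lists X \<Longrightarrow> deriv w (canon w) (strip (nf w))"
  using deriv_norm deriv_del[OF nf_in] by (auto simp: canon_def)

text \<open>The two ends of a unit edge have different lengths, hence different \<open>nf\<close>,
  and \<open>norm\<close> alone cannot be compared along it. Here the part after
  \<open>canon w\<close> depends on \<open>strip (nf w)\<close> alone, which is the same at both
  ends.\<close>

lemma homot_canon_Cons:
  assumes "a \<in> X" "w \<in> lists X"
  shows "homot (a # w) (canon (a # w))
    (act [a] (canon w) [] @ pass a (strip (nf w)) @ del (passw a (strip (nf w))))"
proof -
  obtain k where k: "nf w = strip (nf w) @ replicate k e"
    using normal_strip[OF nf_in normal_nf] assms by blast
  have "homot (a # nf w) (pass a (nf w) @ del (passw a (nf w)))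
      (act [a] (del (nf w)) [] @ pass a (strip (nf w)) @ del (passw a (strip (nf w))))"
    using homot_pass_del_replicate[OF assms(1) nf_in[OF assms(2)], of k] by (simp flip: k)
  from homot_append_left[OF deriv_act_hd[OF deriv_norm[OF assms(2)] assms(1)] this]
  show ?thesis by (simp add: canon_def)
qed

lemma homot_canon_unit:
  assumes "u \<in> lists X" "v \<in> lists X"
  shows "homot (u @ e # v) (canon (u @ e # v)) (unit_edge u v # canon (u @ v))"
  using assms(1)
proof (induction u rule: list.induct)
  case Nil
  have "deriv (e # v) (act [e] (norm v) []) (e # nf v)"
    using deriv_act_hd[OF deriv_norm[OF assms(2)]] by simp
  from homot_append_left[OF this homot_pass_unit[OF nf_in[OF assms(2)]]]
  have "homot (e # v) (canon (e # v)) (act [e] (norm v) [] @ unit_edge [] (nf v) # del (nf v))"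
    using assms by (simp add: canon_def passw_unit nf_in)
  moreover have "homot (e # v) ((act [e] (norm v) [] @ [unit_edge [] (nf v)]) @ del (nf v))
      ((unit_edge [] v # norm v) @ del (nf v))"
  proof (rule homot_append_right_deriv)
    have "deriv [e] [unit_edge [] []] []" by simp
    from homot_sym[OF interchange[OF this deriv_norm[OF assms(2)]]]
    show "homot (e # v) (act [e] (norm v) [] @ [unit_edge [] (nf v)]) (unit_edge [] v # norm v)"
      by simp
    show "deriv (e # v) ((act [e] (norm v) [] @ [unit_edge [] (nf v)]) @ del (nf v)) (strip (nf v))"
      using deriv_act_hd[OF deriv_norm[OF assms(2)], of e] deriv_del[OF nf_in[OF assms(2)]]
        nf_in[OF assms(2)] by auto
  qed
  ultimately show ?case by (auto simp: canon_def intro: homot_trans)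
next
  case (Cons x u)
  let ?w = "u @ e # v" and ?w' = "u @ v"
  have X: "x \<in> X" "u \<in> lists X" using Cons by auto
  have w: "?w \<in> lists X" "?w' \<in> lists X" using X assms by auto
  note IH = Cons.IH[OF X(2)]
  have "deriv ?w (canon ?w) (strip (nf ?w'))"
    unfolding homot_deriv_iff[OF IH] using X assms deriv_canon[OF w(2)] by simp
  from deriv_unique[OF deriv_canon[OF w(1)] this] have nf: "strip (nf ?w) = strip (nf ?w')" .
  let ?T = "pass x (strip (nf ?w)) @ del (passw x (strip (nf ?w)))"
  have T: "deriv (x # strip (nf ?w)) ?T (strip (passw x (strip (nf ?w))))"
    using nf_in[OF w(1)] by (intro deriv_pass_del X) auto
  have "homot (x # ?w) (canon (x # ?w)) (act [x] (canon ?w) [] @ ?T)"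
    by (rule homot_canon_Cons[OF X(1) w(1)])
  also have "homot (x # ?w) (act [x] (canon ?w) [] @ ?T)
      (act [x] (unit_edge u v # canon ?w') [] @ ?T)"
    by (rule homot_append_right[OF homot_act_hd[OF IH X(1)] deriv_act_hd[OF deriv_canon[OF w(1)] X(1)] T])
  finally (homot_trans) have "homot (x # ?w) (canon (x # ?w))
      (unit_edge (x # u) v # (act [x] (canon ?w') [] @ ?T))" by simp
  moreover have "homot (x # ?w') (act [x] (canon ?w') [] @ ?T) (canon (x # ?w'))"
    using homot_sym[OF homot_canon_Cons[OF X(1) w(2)]] by (simp add: nf)
  then have "homot (x # ?w) (unit_edge (x # u) v # (act [x] (canon ?w') [] @ ?T))
      (unit_edge (x # u) v # canon (x # ?w'))"
    using X assms by (intro homot_Cons) auto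
  ultimately show ?case by (auto intro: homot_trans)
qed

lemma homot_canon_swap:
  assumes "u \<in> lists X" "a \<in> X" "b \<in> X" "v \<in> lists X"
  shows "homot (u @ a # b # v) (canon (u @ a # b # v))
    (swap_edge u a b v # canon (u @ l a b # r a b # v))"
proof -
  let ?w = "u @ a # b # v" and ?w' = "u @ l a b # r a b # v"
  have w: "?w \<in> lists X" "?w' \<in> lists X" using assms by auto
  note sw = homot_norm_swap[OF assms]
  have "deriv ?w (norm ?w) (nf ?w')"
    unfolding homot_deriv_iff[OF sw] using assms deriv_norm[OF w(2)] by simp
  from deriv_unique[OF deriv_norm[OF w(1)] this] have nf: "nf ?w = nf ?w'" .
  from homot_append_right[OF sw deriv_norm[OF w(1)] deriv_del[OF nf_in[OF w(1)]]]
  show ?thesis by (simp add: canon_def nf)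
qed

lemma H_eq_parallelism: "H = parallelism X rels"
proof (rule parallelism_if_coherent[OF deriv_canon])
  fix u s v assume a: "u \<in> lists X" "s \<in> rels" "v \<in> lists X"
  from a(2) consider "s = ([e], [])" | a b where "a \<in> X" "b \<in> X" "s = swap_rel a b"
    by (auto simp: rels_def)
  then show "homot (u @ fst s @ v) (canon (u @ fst s @ v)) ((u, s, True, v) # canon (u @ snd s @ v))"
  proof cases
    case 1
    with homot_canon_unit[OF a(1,3)] show ?thesis by (simp add: unit_edge_def)
  next
    case 2
    with homot_canon_swap[OF a(1) 2(1,2) a(3)] show ?thesis
      by (simp add: swap_edge_def swap_rel_def)
  qed
qed

end

theorem (in braided_idempotent) fdt_presentation_rels: "fdt_presentation X rels"
proof -
  have "homotopy_relation X rels (generated_homotopy X rels cells)"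
    using homotopy_relation_generated[OF presentation_rels cells_parallel] .
  moreover have "cells \<subseteq> generated_homotopy X rels cells"
    by (auto simp: generated_homotopy_def)
  \<comment> \<open>Coherence holds for every homotopy relation containing the cells; it is applied
    to the smallest one.\<close>
  ultimately interpret braided_homotopy X l r e "generated_homotopy X rels cells"
    by unfold_locales
  show ?thesis
    using finite_presentation_rels finite_cells cells_parallel H_eq_parallelism
    by (auto simp: fdt_presentation_def)
qed

section \<open>Pitman transforms of columns\<close>

fun rmax :: "(nat \<Rightarrow> int) \<Rightarrow> nat \<Rightarrow> int" where
  "rmax h 0 = h 0"
| "rmax h (Suc k) = max (rmax h k) (h (Suc k))"

lemma rmax_ge: "s \<le> t \<Longrightarrow> h s \<le> rmax h t"
proof (induction t)
  case (Suc t)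
  then show ?case by (cases "s = Suc t") auto
qed simp

lemma rmax_attained: "\<exists>s\<le>t. rmax h t = h s"
proof (induction t)
  case (Suc t)
  then obtain s where "s \<le> t" "rmax h t = h s" by blast
  then show ?case
    by (cases "h (Suc t) \<le> h s") (auto simp: max_def intro: exI[of _ s] exI[of _ "Suc t"])
qed simp

lemma rmax_mono: "s \<le> t \<Longrightarrow> rmax h s \<le> rmax h t"
  by (induction t) (auto simp: le_Suc_eq)

lemma rmax_leI: "(\<And>s. s \<le> t \<Longrightarrow> h s \<le> m) \<Longrightarrow> rmax h t \<le> m"
  using rmax_attained[of t h] by auto

text \<open>A discrete intermediate value argument: when the running maximum first exceeds its value
  at \<open>r\<close>, \<open>g\<close> has risen by at most one, so just before it stood exactly at
  that value.\<close>

lemma rmax_crossing: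
  assumes step: "\<And>k. g (Suc k) \<le> g k + 1" and "r \<le> t" and "rmax g r < rmax g t"
  shows "\<exists>s. r \<le> s \<and> s \<le> t \<and> rmax g s = rmax g r \<and> g s = rmax g r"
  using assms(2,3)
proof (induction t)
  case (Suc t)
  show ?case
  proof (cases "r \<le> t \<and> rmax g r < rmax g t")
    case True
    with Suc show ?thesis by (meson le_SucI)
  next
    case False
    have "r \<noteq> Suc t" using Suc.prems by auto
    with Suc.prems have "r \<le> t" by simp
    with False have eq: "rmax g t = rmax g r" using rmax_mono[of r t g] by auto
    with Suc.prems have "g (Suc t) > rmax g r" by auto
    moreover have "g t \<le> rmax g t" by (rule rmax_ge) simp
    ultimately have "g t = rmax g r" using step[of t] eq by linarith
    with eq \<open>r \<le> t\<close> show ?thesis by (intro exI[of _ t]) auto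
  qed
qed auto

text \<open>The braid relation for Pitman transforms, in the coordinates \<open>g = b - a\<close>, \<open>h = c - b\<close> of three
  paths \<open>a, b, c\<close>.\<close>

lemma pitman_identity:
  fixes g h :: "nat \<Rightarrow> int"
  assumes step: "\<And>k. g (Suc k) \<le> g k + 1"
  shows "rmax g t + rmax (\<lambda>s. g s - 2 * rmax g s + rmax (\<lambda>r. h r + rmax g r) s) t
       = rmax (\<lambda>s. g s + rmax h s) t"
proof (rule antisym)
  obtain s where s: "s \<le> t"
    "rmax (\<lambda>s. g s - 2 * rmax g s + rmax (\<lambda>r. h r + rmax g r) s) t
      = g s - 2 * rmax g s + rmax (\<lambda>r. h r + rmax g r) s"
    using rmax_attained[of t "\<lambda>s. g s - 2 * rmax g s + rmax (\<lambda>r. h r + rmax g r) s"] by blast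
  obtain r where r: "r \<le> s" "rmax (\<lambda>r. h r + rmax g r) s = h r + rmax g r"
    using rmax_attained[of s "\<lambda>r. h r + rmax g r"] by blast
  have m: "rmax g r \<le> rmax g s" "rmax g s \<le> rmax g t" "g s \<le> rmax g s"
    using rmax_mono[OF r(1)] rmax_mono[OF s(1)] rmax_ge[of s s] by auto
  \<comment> \<open>Since \<open>r \<le> s'\<close>, the value \<open>h r\<close> may be replaced by
    \<open>rmax h s'\<close>. If \<open>g\<close> has its maximum over \<open>0..t\<close> already
    by \<open>r\<close>, take \<open>s\<close> itself; otherwise a position of this maximum lies
    after \<open>r\<close> and serves.\<close>
  obtain s' where s': "r \<le> s'" "s' \<le> t" "rmax g t + rmax g r + g s - 2 * rmax g s \<le> g s'"
  proof (cases "rmax g t = rmax g r")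
    case True
    with m r s show ?thesis by (intro that[of s]) auto
  next
    case False
    obtain s' where a: "s' \<le> t" "rmax g t = g s'" using rmax_attained by blast
    have "r \<le> s'"
    proof (rule ccontr)
      assume "\<not> r \<le> s'"
      then have "g s' \<le> rmax g r" by (intro rmax_ge) auto
      with a False m show False by linarith
    qed
    with a m show ?thesis by (intro that[of s']) auto
  qed
  have "h r \<le> rmax h s'" by (rule rmax_ge) fact
  moreover have "g s' + rmax h s' \<le> rmax (\<lambda>s. g s + rmax h s) t"
    using rmax_ge[OF s'(2), of "\<lambda>s. g s + rmax h s"] .
  ultimately show "rmax g t + rmax (\<lambda>s. g s - 2 * rmax g s + rmax (\<lambda>r. h r + rmax g r) s) t
      \<le> rmax (\<lambda>s. g s + rmax h s) t"
    using s r s' by linarith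
next
  obtain s where s: "s \<le> t" "rmax (\<lambda>s. g s + rmax h s) t = g s + rmax h s"
    using rmax_attained[of t "\<lambda>s. g s + rmax h s"] by blast
  obtain r where r: "r \<le> s" "rmax h s = h r" using rmax_attained by blast
  have m: "g s \<le> rmax g s" "rmax g r \<le> rmax g s" "rmax g s \<le> rmax g t"
    using rmax_mono[OF r(1)] rmax_mono[OF s(1)] rmax_ge[of s s] by auto
  \<comment> \<open>Again \<open>s\<close> serves if the running maximum is constant from
    \<open>r\<close> to \<open>t\<close>. Otherwise \<open>s'\<close> is the crossing, where
    \<open>g\<close>, its running maximum and \<open>rmax g r\<close> agree.\<close>
  obtain s' where s': "r \<le> s'" "s' \<le> t" "g s \<le> rmax g t + rmax g r + g s' - 2 * rmax g s'"
  proof (cases "rmax g t = rmax g r")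
    case True
    with m r s show ?thesis by (intro that[of s]) auto
  next
    case False
    with m have "rmax g r < rmax g t" by linarith
    from rmax_crossing[OF step _ this] r s obtain s' where
      "r \<le> s'" "s' \<le> t" "rmax g s' = rmax g r" "g s' = rmax g r" by auto
    with m show ?thesis by (intro that[of s']) auto
  qed
  have "h r + rmax g r \<le> rmax (\<lambda>r. h r + rmax g r) s'"
    using rmax_ge[OF s'(1), of "\<lambda>r. h r + rmax g r"] .
  moreover have "g s' - 2 * rmax g s' + rmax (\<lambda>r. h r + rmax g r) s'
      \<le> rmax (\<lambda>s. g s - 2 * rmax g s + rmax (\<lambda>r. h r + rmax g r) s) t"
    using rmax_ge[OF s'(2), of "\<lambda>s. g s - 2 * rmax g s + rmax (\<lambda>r. h r + rmax g r) s"] .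
  ultimately show "rmax (\<lambda>s. g s + rmax h s) t
      \<le> rmax g t + rmax (\<lambda>s. g s - 2 * rmax g s + rmax (\<lambda>r. h r + rmax g r) s) t"
    using s r s' by linarith
qed

section \<open>Columns and their counting functions\<close>

definition cnt :: "nat set \<Rightarrow> nat \<Rightarrow> int" where
  "cnt A k = int (card (A \<inter> {..<k}))"

lemma cnt_0 [simp]: "cnt A 0 = 0" by (simp add: cnt_def)

lemma cnt_Suc: "cnt A (Suc k) = cnt A k + of_bool (k \<in> A)"
proof -
  have "A \<inter> {..<Suc k} = (if k \<in> A then insert k (A \<inter> {..<k}) else A \<inter> {..<k})"
    by (auto simp: less_Suc_eq)
  then show ?thesis by (simp add: cnt_def)
qed

lemma cnt_eqI:
  assumes "cnt A = cnt B"
  shows "A = B"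
proof (rule Set.set_eqI)
  fix k
  from assms have "of_bool (k \<in> A) = (of_bool (k \<in> B) :: int)"
    using cnt_Suc[of A k] cnt_Suc[of B k] by simp
  then show "k \<in> A \<longleftrightarrow> k \<in> B" by (cases "k \<in> A"; cases "k \<in> B") simp_all
qed

text \<open>Read the letters in increasing order, those only in \<open>A\<close> as opening and those only in \<open>B\<close> as closing
  parentheses. Then \<open>surplus A B k\<close> counts the unmatched closing parentheses below \<open>k\<close>.\<close>

definition surplus :: "nat set \<Rightarrow> nat set \<Rightarrow> nat \<Rightarrow> int" where
  "surplus A B = rmax (\<lambda>k. cnt B k - cnt A k)"

text \<open>\<open>cnt\<close> counts letters strictly below its argument, so a rise of the surplus
  from \<open>k\<close> to \<open>Suc k\<close> is due to the letter \<open>k\<close>.\<close>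

definition unmatched :: "nat set \<Rightarrow> nat set \<Rightarrow> nat set" where
  "unmatched A B = {k. surplus A B k < surplus A B (Suc k)}"

definition colL :: "nat set \<Rightarrow> nat set \<Rightarrow> nat set" where
  "colL A B = A \<union> unmatched A B"

definition colR :: "nat set \<Rightarrow> nat set \<Rightarrow> nat set" where
  "colR A B = B - unmatched A B"

lemma surplus_Suc:
  "surplus A B (Suc k) = surplus A B k + of_bool (k \<in> unmatched A B)"
  and unmatched_D: "k \<in> unmatched A B \<Longrightarrow> k \<in> B \<and> k \<notin> A"
proof -
  have "cnt B k - cnt A k \<le> surplus A B k"
    unfolding surplus_def using rmax_ge[of k k "\<lambda>k. cnt B k - cnt A k"] by simp
  then show "surplus A B (Suc k) = surplus A B k + of_bool (k \<in> unmatched A B)"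
    and "k \<in> unmatched A B \<Longrightarrow> k \<in> B \<and> k \<notin> A"
    by (auto simp: surplus_def unmatched_def cnt_Suc max_def of_bool_def split: if_splits)
qed

text \<open>With \<open>cnt_colR\<close> this identifies \<open>N\<close> as the Pitman transform:
  the counting functions \<open>(a, b)\<close> become \<open>(a + M, b - M)\<close>, where
  \<open>M\<close> is the running maximum of \<open>b - a\<close>.\<close>

lemma cnt_colL: "cnt (colL A B) k = cnt A k + surplus A B k"
proof (induction k)
  case (Suc k)
  then show ?case using unmatched_D[of k A B] by (auto simp: cnt_Suc surplus_Suc colL_def)
qed (simp add: surplus_def)

lemma cnt_colR: "cnt (colR A B) k = cnt B k - surplus A B k"
proof (induction k)
  case (Suc k)
  then show ?case using unmatched_D[of k A B] by (auto simp: cnt_Suc surplus_Suc colR_def)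
qed (simp add: surplus_def)

text \<open>Written in counting functions, both sides are \<open>cnt A\<close> plus running maxima;
  after cancelling \<open>cnt A\<close>, \<open>pitman_identity\<close> remains.\<close>

lemma colL_braid:
  "colL (colL A B) (colL (colR A B) C) = colL A (colL B C)"
proof (rule cnt_eqI, rule ext)
  fix t
  define g h where "g = (\<lambda>k. cnt B k - cnt A k)" and "h = (\<lambda>k. cnt C k - cnt B k)"
  have 1: "surplus A B = rmax g" "surplus B C = rmax h"
    by (simp_all add: surplus_def g_def h_def)
  have 2: "surplus (colR A B) C = rmax (\<lambda>r. h r + rmax g r)"
    unfolding surplus_def[of "colR A B"] cnt_colR 1 by (rule arg_cong[of _ _ rmax]) (auto simp: h_def)
  have 3: "surplus (colL A B) (colL (colR A B) C)
      = rmax (\<lambda>s. g s - 2 * rmax g s + rmax (\<lambda>r. h r + rmax g r) s)"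
    unfolding surplus_def[of "colL A B"] cnt_colL cnt_colR 1 2
    by (rule arg_cong[of _ _ rmax]) (auto simp: g_def)
  have 4: "surplus A (colL B C) = rmax (\<lambda>s. g s + rmax h s)"
    unfolding surplus_def[of A] cnt_colL 1 by (rule arg_cong[of _ _ rmax]) (auto simp: g_def)
  have "rmax g t + rmax (\<lambda>s. g s - 2 * rmax g s + rmax (\<lambda>r. h r + rmax g r) s) t
       = rmax (\<lambda>s. g s + rmax h s) t"
    by (rule pitman_identity) (simp add: g_def cnt_Suc)
  then show "cnt (colL (colL A B) (colL (colR A B) C)) t = cnt (colL A (colL B C)) t"
    unfolding cnt_colL 1 3 4 by linarith
qed

text \<open>The mirror image of \<open>colL_braid\<close>: the same identity with the two
  differences exchanging roles.\<close>

lemma colR_braid: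
  "colR (colR A B) C = colR (colR A (colL B C)) (colR B C)"
proof (rule cnt_eqI, rule ext)
  fix t
  define g h where "g = (\<lambda>k. cnt C k - cnt B k)" and "h = (\<lambda>k. cnt B k - cnt A k)"
  have 1: "surplus A B = rmax h" "surplus B C = rmax g"
    by (simp_all add: surplus_def g_def h_def)
  have 2: "surplus A (colL B C) = rmax (\<lambda>r. h r + rmax g r)"
    unfolding surplus_def[of A] cnt_colL 1 by (rule arg_cong[of _ _ rmax]) (auto simp: h_def)
  have 3: "surplus (colR A (colL B C)) (colR B C)
      = rmax (\<lambda>s. g s - 2 * rmax g s + rmax (\<lambda>r. h r + rmax g r) s)"
    unfolding surplus_def[of "colR A (colL B C)"] cnt_colL cnt_colR 1 2
    by (rule arg_cong[of _ _ rmax]) (auto simp: g_def)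
  have 4: "surplus (colR A B) C = rmax (\<lambda>s. g s + rmax h s)"
    unfolding surplus_def[of "colR A B"] cnt_colR 1
    by (rule arg_cong[of _ _ rmax]) (auto simp: g_def)
  have "rmax g t + rmax (\<lambda>s. g s - 2 * rmax g s + rmax (\<lambda>r. h r + rmax g r) s) t
       = rmax (\<lambda>s. g s + rmax h s) t"
    by (rule pitman_identity) (simp add: g_def cnt_Suc)
  then show "cnt (colR (colR A B) C) t = cnt (colR (colR A (colL B C)) (colR B C)) t"
    unfolding cnt_colR 1 3 4 by linarith
qed

lemma cnt_colLR: "cnt (colL A B) k + cnt (colR A B) k = cnt A k + cnt B k"
  by (simp add: cnt_colL cnt_colR)

text \<open>\<open>N\<close> preserves the sum of the two counting functions, so the middle column
  is determined by the outer two.\<close>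

lemma colLR_braid:
  "colR (colL A B) (colL (colR A B) C)
    = colL (colR A (colL B C)) (colR B C)"
proof (rule cnt_eqI, rule ext)
  fix t
  show "cnt (colR (colL A B) (colL (colR A B) C)) t
      = cnt (colL (colR A (colL B C)) (colR B C)) t"
    using cnt_colLR[of A B t] cnt_colLR[of "colR A B" C t]
      cnt_colLR[of "colL A B" "colL (colR A B) C" t]
      cnt_colLR[of B C t] cnt_colLR[of A "colL B C" t]
      cnt_colLR[of "colR A (colL B C)" "colR B C" t]
    colL_braid[of A B C] colR_braid[of A B C] by simp
qed

text \<open>\<open>N\<close> turns the difference \<open>b - a\<close> into
  \<open>b - a - 2 M\<close>, with \<open>M\<close> its running maximum, and this is at most
  \<open>- M\<close>, hence at most 0. In tableau terms, the two columns fit side by side.\<close>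

lemma surplus_col: "surplus (colL A B) (colR A B) k = 0"
proof (rule antisym)
  have 0: "0 \<le> surplus A B k" for k
    using rmax_ge[of 0 k "\<lambda>k. cnt B k - cnt A k"] by (simp add: surplus_def)
  show "surplus (colL A B) (colR A B) k \<le> 0"
    unfolding surplus_def
  proof (rule rmax_leI)
    fix s
    show "cnt (colR A B) s - cnt (colL A B) s \<le> 0"
      using rmax_ge[of s s "\<lambda>k. cnt B k - cnt A k"] 0[of s]
      by (simp add: cnt_colL cnt_colR surplus_def)
  qed
  show "0 \<le> surplus (colL A B) (colR A B) k"
    using rmax_ge[of 0 k "\<lambda>k. cnt (colR A B) k - cnt (colL A B) k"] by (simp add: surplus_def)
qed

lemma unmatched_col: "unmatched (colL A B) (colR A B) = {}"
  by (simp add: unmatched_def surplus_col)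

lemma colL_idem: "colL (colL A B) (colR A B) = colL A B"
  and colR_idem: "colR (colL A B) (colR A B) = colR A B"
  using unmatched_col[of A B] by (simp_all add: colL_def colR_def)

section \<open>Products with empty and one-letter columns\<close>

lemma unmatchedI:
  assumes U: "\<And>k. surplus A B k = cnt U k"
  shows "unmatched A B = U"
  by (auto simp: unmatched_def U cnt_Suc)

text \<open>A criterion for \<open>cnt U\<close> to be the running maximum of the difference: it is
  an upper bound, and each jump, made by a letter \<open>k\<close>, is attained at
  \<open>Suc k\<close>.\<close>

lemma unmatched_eqI:
  assumes ge: "\<And>k. cnt B k - cnt A k \<le> cnt U k"
    and le: "\<And>k. k \<in> U \<Longrightarrow> cnt U (Suc k) \<le> cnt B (Suc k) - cnt A (Suc k)"
  shows "unmatched A B = U"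
proof (rule unmatchedI)
  fix k show "surplus A B k = cnt U k"
    unfolding surplus_def
  proof (induction k)
    case (Suc k)
    then show ?case using ge[of "Suc k"] le[of k] by (cases "k \<in> U") (auto simp: cnt_Suc)
  qed simp
qed

lemma cnt_empty [simp]: "cnt {} k = 0"
  by (simp add: cnt_def)

lemma cnt_nonneg [simp]: "0 \<le> cnt A k"
  by (simp add: cnt_def)

lemma cnt_singleton: "cnt {x} k = of_bool (x < k)"
  by (induction k) (auto simp: cnt_Suc)

lemma cnt_remove: "y \<in> B \<Longrightarrow> cnt (B - {y}) k = cnt B k - of_bool (y < k)"
  by (induction k) (auto simp: cnt_Suc less_Suc_eq)

lemma col_empty_left [simp]: "colL {} B = B" "colR {} B = {}"
proof -
  have "unmatched {} B = B" by (rule unmatched_eqI) simp_all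
  then show "colL {} B = B" "colR {} B = {}" by (simp_all add: colL_def colR_def)
qed

lemma col_empty_right [simp]: "colL A {} = A" "colR A {} = {}"
proof -
  have "unmatched A {} = {}" by (rule unmatched_eqI) simp_all
  then show "colL A {} = A" "colR A {} = {}" by (simp_all add: colL_def colR_def)
qed

lemma col_append:
  assumes "\<And>b. b \<in> B \<Longrightarrow> b < x"
  shows "colL {x} B = insert x B" "colR {x} B = {}"
proof -
  have "unmatched {x} B = B"
    by (rule unmatched_eqI) (auto simp: cnt_singleton dest: assms)
  then show "colL {x} B = insert x B" "colR {x} B = {}" by (simp_all add: colL_def colR_def)
qed

text \<open>Column insertion: \<open>x\<close> bumps the smallest letter of \<open>B\<close> that is
  not below it. If \<open>x < y\<close>, the single opening parenthesis \<open>x\<close> is closed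
  by \<open>y\<close>; if \<open>x = y\<close>, this letter lies in both columns and is no
  parenthesis. The other letters of \<open>B\<close> stay unmatched.\<close>

lemma col_bump:
  assumes "y \<in> B" "x \<le> y" "\<And>b. b \<in> B \<Longrightarrow> x \<le> b \<Longrightarrow> y \<le> b"
  shows "colL {x} B = insert x (B - {y})" "colR {x} B = {y}"
proof -
  have "unmatched {x} B = B - {y}"
    by (rule unmatched_eqI) (use assms in \<open>auto simp: cnt_singleton cnt_remove less_Suc_eq_le\<close>)
  then show "colL {x} B = insert x (B - {y})" "colR {x} B = {y}"
    using assms by (auto simp: colL_def colR_def)
qed

lemma col_subset: "colL A B \<subseteq> A \<union> B" "colR A B \<subseteq> B"
  using unmatched_D[of _ A B] by (auto simp: colL_def colR_def)

section \<open>Column words and column insertion by Knuth relations\<close>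

definition colword :: "nat set \<Rightarrow> nat list" where
  "colword A = rev (sorted_list_of_set A)"

lemma colword_set: "sorted_wrt (>) xs \<Longrightarrow> colword (set xs) = xs"
proof -
  assume a: "sorted_wrt (>) xs"
  then have "sorted_wrt (<) (rev xs)" by (simp add: sorted_wrt_rev)
  then have "sorted_list_of_set (set (rev xs)) = rev xs"
    by (intro sorted_list_of_set.idem_if_sorted_distinct) (auto simp: strict_sorted_iff)
  then show ?thesis by (simp add: colword_def)
qed

lemma colword_sorted: "sorted_wrt (>) (colword A)"
  by (simp add: colword_def sorted_wrt_rev)

lemma set_colword [simp]: "finite A \<Longrightarrow> set (colword A) = A"
  by (simp add: colword_def)

lemma colword_empty [simp]: "colword {} = []"
  by (simp add: colword_def)

lemma colword_singleton [simp]: "colword {x} = [x]"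
  by (simp add: colword_def)

lemma colword_insert_max:
  assumes "finite A" "\<And>a. a \<in> A \<Longrightarrow> a < x"
  shows "colword (insert x A) = x # colword A"
  using colword_set[of "x # colword A"] assms by (simp add: colword_sorted)

abbreviation plac :: "nat \<Rightarrow> (nat list \<times> nat list) set" where
  "plac n \<equiv> presented_congruence {1..n} (plactic_relations n)"

lemma presentation_plactic: "presentation {1..n} (plactic_relations n)"
  by (auto simp: presentation_def plactic_relations_def)

lemma knuth1:
  assumes "{x, y, z} \<subseteq> {1..n}" "x \<le> y" "y < z" "u \<in> lists {1..n}"
  shows "(x # z # y # u, z # x # y # u) \<in> plac n"
proof -
  have "([x, z, y], [z, x, y]) \<in> plactic_relations n"
    using assms by (auto simp: plactic_relations_def)
  from presented_congruence.rel[OF _ assms(4) this, of "[]"] show ?thesis by simp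
qed

lemma knuth2:
  assumes "{x, y, z} \<subseteq> {1..n}" "x < y" "y \<le> z" "u \<in> lists {1..n}"
  shows "(y # x # z # u, y # z # x # u) \<in> plac n"
proof -
  have "([y, x, z], [y, z, x]) \<in> plactic_relations n"
    using assms unfolding plactic_relations_def by blast
  from presented_congruence.rel[OF _ assms(4) this, of "[]"] show ?thesis by simp
qed

lemma congruence_left:
  assumes "(w, w') \<in> presented_congruence X S" "x \<in> lists X"
  shows "(x @ w, x @ w') \<in> presented_congruence X S"
  using presented_congruence_context[OF assms, of "[]"] by simp

lemma congruence_right:
  assumes "(w, w') \<in> presented_congruence X S" "y \<in> lists X"
  shows "(w @ y, w' @ y) \<in> presented_congruence X S"
  using presented_congruence_context[OF assms(1) _ assms(2), of "[]"] by simp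

lemma congruence_Cons:
  assumes "(w, w') \<in> presented_congruence X S" "x \<in> X"
  shows "(x # w, x # w') \<in> presented_congruence X S"
  using congruence_left[OF assms(1), of "[x]"] assms(2) by simp

text \<open>The relation \<open>xzy = zxy\<close> moves \<open>x\<close> past a larger letter when a
  letter between the two follows. This is the next letter of \<open>us\<close> or, at the end,
  \<open>y\<close>.\<close>

lemma knuth_pass_large:
  assumes "sorted_wrt (>) (us @ [y])" "x \<le> y" "x \<in> {1..n}" "set (us @ y # vs) \<subseteq> {1..n}"
  shows "(x # us @ y # vs, us @ x # y # vs) \<in> plac n"
  using assms
proof (induction us)
  case Nil
  then have "x # y # vs \<in> lists {1..n}" by auto
  from presented_congruence.refl[OF this] show ?case by simp
next
  case (Cons u us)
  obtain h ts where h: "us @ y # vs = h # ts" by (cases us) auto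
  have "h \<in> set (us @ [y])" using h by (cases us) auto
  with Cons.prems have "x \<le> h" "h < u" by (auto simp: sorted_wrt_append)
  moreover have "set (h # ts) \<subseteq> {1..n}" using Cons.prems(4) h[symmetric] by auto
  ultimately have "(x # u # h # ts, u # x # h # ts) \<in> plac n"
    using Cons.prems by (intro knuth1) auto
  moreover have "(u # x # us @ y # vs, u # us @ x # y # vs) \<in> plac n"
    using Cons by (intro congruence_Cons) auto
  ultimately show ?case using presented_congruence.trans by (simp add: h) blast
qed

text \<open>The second Knuth relation moves \<open>y\<close> past \<open>v\<close> when a letter
  between them stands just before \<open>y\<close>. This is \<open>x\<close> at first, and
  afterwards the letter passed last.\<close>

lemma knuth_pass_small:
  assumes "sorted_wrt (>) vs" "x \<le> y" "\<forall>v\<in>set vs. v < x" "{x, y} \<union> set vs \<subseteq> {1..n}"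
  shows "(x # y # vs, x # vs @ [y]) \<in> plac n"
  using assms
proof (induction vs arbitrary: x)
  case Nil
  then have "[x, y] \<in> lists {1..n}" by auto
  from presented_congruence.refl[OF this] show ?case by simp
next
  case (Cons v vs)
  have "(x # y # v # vs, x # v # y # vs) \<in> plac n"
    using Cons.prems by (intro presented_congruence.sym[OF knuth2]) auto
  moreover have "(v # y # vs, v # vs @ [y]) \<in> plac n"
    using Cons.prems by (intro Cons.IH) auto
  then have "(x # v # y # vs, x # v # vs @ [y]) \<in> plac n"
    by (rule congruence_Cons) (use Cons.prems in auto)
  ultimately show ?case using presented_congruence.trans by simp blast
qed

lemma column_insertion_cases:
  fixes B :: "'a :: linorder set"
  assumes "finite B"
  obtains "\<And>b. b \<in> B \<Longrightarrow> b < x"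
  | y where "y \<in> B" "x \<le> y" "\<And>b. b \<in> B \<Longrightarrow> x \<le> b \<Longrightarrow> y \<le> b"
proof (cases "\<forall>b\<in>B. b < x")
  case False
  define y where "y = Min {b \<in> B. x \<le> b}"
  have "{b \<in> B. x \<le> b} \<noteq> {}" using False by (auto simp: not_less)
  then have "y \<in> {b \<in> B. x \<le> b}" unfolding y_def using assms by (intro Min_in) auto
  moreover have "y \<le> b" if "b \<in> B" "x \<le> b" for b
    unfolding y_def using assms that by (intro Min_le) auto
  ultimately show ?thesis using that(2) by blast
qed (use that in blast)

lemma plac_column_insertion:
  assumes "x \<in> {1..n}" "B \<subseteq> {1..n}"
  shows "(x # colword B, colword (colL {x} B) @ colword (colR {x} B)) \<in> plac n"
proof -
  have B: "finite B" using assms(2) finite_subset by blast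
  from B show ?thesis
  proof (cases rule: column_insertion_cases[of B x])
    case 1
    have "x # colword B \<in> lists {1..n}" using assms B by auto
    from presented_congruence.refl[OF this] 1 show ?thesis
      using B by (simp add: col_append colword_insert_max)
  next
    case (2 y)
    \<comment> \<open>The letters of \<open>us\<close> exceed \<open>y\<close> and those of
      \<open>vs\<close> are below \<open>x\<close>, so \<open>x\<close> can move past
      \<open>us\<close> and then \<open>y\<close> past \<open>vs\<close>.\<close>
    from 2(1) B obtain us vs where e: "colword B = us @ y # vs"
      by (metis set_colword split_list)
    have s: "sorted_wrt (>) (us @ y # vs)" using colword_sorted[of B] by (simp add: e)
    have set: "set (us @ y # vs) = B" using set_colword[OF B] by (simp add: e)
    have small: "v < x" if "v \<in> set vs" for v
      using 2(3)[of v] that s set by (fastforce simp: sorted_wrt_append)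
    have in_n: "set us \<subseteq> {1..n}" "set vs \<subseteq> {1..n}" "y \<in> {1..n}"
      using set assms(2) by auto
    have s': "sorted_wrt (>) (us @ x # vs)"
      using s small 2(2) by (fastforce simp: sorted_wrt_append)
    have "set (us @ x # vs) = insert x (B - {y})"
      using s by (auto simp: set[symmetric] sorted_wrt_append)
    with colword_set[OF s'] have c: "colword (insert x (B - {y})) = us @ x # vs" by simp
    have "(x # us @ y # vs, us @ x # y # vs) \<in> plac n"
      using s 2(2) assms in_n by (intro knuth_pass_large) (auto simp: sorted_wrt_append)
    moreover have "(us @ x # y # vs, us @ x # vs @ [y]) \<in> plac n"
      using s 2(2) assms in_n small
      by (intro congruence_left knuth_pass_small) (auto simp: sorted_wrt_append)
    ultimately show ?thesis
      using col_bump[OF 2] presented_congruence.trans by (simp add: c e) blast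
  qed
qed

text \<open>Split off the largest letter \<open>x\<close> of \<open>A\<close>: the braid relation for \<open>{x}, A - {x}, B\<close> computes the product
  of \<open>A\<close> and \<open>B\<close> by column insertions of single letters.\<close>

lemma plac_column_product:
  assumes "A \<subseteq> {1..n}" "B \<subseteq> {1..n}"
  shows "(colword A @ colword B, colword (colL A B) @ colword (colR A B)) \<in> plac n"
proof -
  have fin: "finite C" and colword_in: "colword C \<in> lists {1..n}" if "C \<subseteq> {1..n}" for C
  proof -
    show "finite C" using that finite_subset by blast
    then show "colword C \<in> lists {1..n}" using that by auto
  qed
  from fin[OF assms(1)] assms(1) show ?thesis
  proof (induction A rule: finite_linorder_max_induct)
    case empty
    then show ?case using colword_in[OF assms(2)] by (simp add: presented_congruence.refl)
  next
    case (insert x A)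
    let ?A' = "colL A B" and ?B' = "colR A B"
    let ?G1 = "colL {x} ?A'" and ?G2 = "colR {x} ?A'"
    have x: "x \<in> {1..n}" and A: "A \<subseteq> {1..n}" using insert.prems by auto
    have A': "?A' \<subseteq> {1..n}" and B': "?B' \<subseteq> {1..n}"
      using col_subset[of A B] A assms(2) by auto
    have G2: "?G2 \<subseteq> {1..n}" and G1: "?G1 \<subseteq> {1..n}"
      using col_subset[of "{x}" ?A'] A' x by auto
    have app: "colL {x} A = insert x A" "colR {x} A = {}"
      using insert.hyps by (auto intro!: col_append)
    \<comment> \<open>Multiplying \<open>{x}\<close> and \<open>A\<close> gives
      \<open>insert x A\<close> and an empty column, so one side of the braid relation collapses to
      the product of \<open>insert x A\<close> and \<open>B\<close>.\<close>
    have r: "?G1 = colL (insert x A) B" "colL ?G2 ?B' = colR (insert x A) B" "colR ?G2 ?B' = {}"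
      using colL_braid[of "{x}" A B] colLR_braid[of "{x}" A B] colR_braid[of "{x}" A B]
      by (simp_all add: app)
    have "(x # (colword A @ colword B), x # (colword ?A' @ colword ?B')) \<in> plac n"
      using insert.IH[OF A] x by (rule congruence_Cons)
    moreover have "((x # colword ?A') @ colword ?B', (colword ?G1 @ colword ?G2) @ colword ?B')
        \<in> plac n"
      using plac_column_insertion[OF x A'] colword_in[OF B'] by (rule congruence_right)
    \<comment> \<open>\<open>?G2\<close> holds what \<open>x\<close> bumped, at most one letter, so
      one more column insertion suffices.\<close>
    moreover have "(colword ?G2 @ colword ?B', colword (colL ?G2 ?B') @ colword (colR ?G2 ?B'))
        \<in> plac n"
    proof (rule column_insertion_cases[OF fin[OF A'], of x])
      assume "\<And>b. b \<in> ?A' \<Longrightarrow> b < x"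
      then show ?thesis using colword_in[OF B'] by (simp add: col_append presented_congruence.refl)
    next
      fix y assume y: "y \<in> ?A'" "x \<le> y" "\<And>b. b \<in> ?A' \<Longrightarrow> x \<le> b \<Longrightarrow> y \<le> b"
      have "y \<in> {1..n}" using y(1) A' by blast
      from plac_column_insertion[OF this B'] show ?thesis using col_bump[OF y] by simp
    qed
    then have "(colword ?G1 @ colword ?G2 @ colword ?B', colword ?G1 @ colword (colR (insert x A) B))
        \<in> plac n"
      using congruence_left[OF _ colword_in[OF G1]] by (simp add: r)
    ultimately show ?case
      using insert.hyps presented_congruence.trans by (simp add: colword_insert_max r(1)) blast
  qed
qed

text \<open>\<open>fdt_monoid\<close> asks for an alphabet of natural numbers, so columns are
  represented by binary codes. The empty column has code 0, which is the unit letter.\<close>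

definition codeL :: "nat \<Rightarrow> nat \<Rightarrow> nat" where
  "codeL a b = set_encode (colL (set_decode a) (set_decode b))"

definition codeR :: "nat \<Rightarrow> nat \<Rightarrow> nat" where
  "codeR a b = set_encode (colR (set_decode a) (set_decode b))"

definition columns :: "nat \<Rightarrow> nat set" where
  "columns n = {c. set_decode c \<subseteq> {1..n}}"

lemma decode_codeL [simp]: "set_decode (codeL a b) = colL (set_decode a) (set_decode b)"
  and decode_codeR [simp]: "set_decode (codeR a b) = colR (set_decode a) (set_decode b)"
  using col_subset[of "set_decode a" "set_decode b"]
  by (simp_all add: codeL_def codeR_def set_encode_inverse finite_subset)

lemma finite_columns: "finite (columns n)"
proof (rule finite_subset)
  show "columns n \<subseteq> set_encode ` Pow {1..n}"
    unfolding columns_def by (metis (mono_tags) PowI image_eqI mem_Collect_eq set_decode_inverse subsetI)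
qed simp

lemma set_decode_eqI: "set_decode a = set_decode b \<Longrightarrow> a = b"
  by (metis set_decode_inverse)

lemma braided_columns: "braided_idempotent (columns n) codeL codeR 0"
proof
  show "finite (columns n)" by (rule finite_columns)
  show "0 \<in> columns n" by (simp add: columns_def)
  fix a b c assume "a \<in> columns n" "b \<in> columns n"
  then show "codeL a b \<in> columns n" "codeR a b \<in> columns n"
    using col_subset[of "set_decode a" "set_decode b"] by (auto simp: columns_def)
  show "codeL (codeL a b) (codeR a b) = codeL a b" "codeR (codeL a b) (codeR a b) = codeR a b"
    by (rule set_decode_eqI, simp add: colL_idem colR_idem)+
  show "codeL (codeL a b) (codeL (codeR a b) c) = codeL a (codeL b c)"
    by (rule set_decode_eqI) (simp add: colL_braid)
  show "codeR (codeL a b) (codeL (codeR a b) c) = codeL (codeR a (codeL b c)) (codeR b c)"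
    by (rule set_decode_eqI) (simp add: colLR_braid)
  show "codeR (codeR a b) c = codeR (codeR a (codeL b c)) (codeR b c)"
    by (rule set_decode_eqI) (simp add: colR_braid[symmetric])
  show "codeL 0 b = b" "codeR 0 b = 0" "codeL a 0 = a" "codeR a 0 = 0"
    by (rule set_decode_eqI, simp)+
qed

section \<open>The column presentation of the Plactic monoid\<close>

lemma presented_congruence_map:
  assumes Y: "presentation Y T"
    and app: "\<And>u v. f (u @ v) = f u @ f v"
    and f: "\<And>w. w \<in> lists X \<Longrightarrow> f w \<in> lists Y"
    and rels: "\<And>l r. (l, r) \<in> S \<Longrightarrow> (f l, f r) \<in> presented_congruence Y T"
    and "(w, w') \<in> presented_congruence X S"
  shows "(f w, f w') \<in> presented_congruence Y T"
  using assms(5)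
proof induction
  case (rel u v l r)
  then show ?case by (simp add: app f rels presented_congruence_context del: in_lists_conv_set)
next
  case (refl w)
  then show ?case by (intro presented_congruence.refl f)
next
  case (sym w w')
  from sym.IH show ?case by (rule presented_congruence.sym)
next
  case (trans w w' w'')
  from trans.IH show ?case by (rule presented_congruence.trans)
qed

text \<open>Substitutions that respect the relations and are inverse to each other up to congruence
  induce mutually inverse maps on the classes.\<close>

lemma presented_monoid_iso:
  assumes X: "presentation X S" and Y: "presentation Y T"
    and f_app: "\<And>u v. f (u @ v) = f u @ f v" and g_app: "\<And>u v. g (u @ v) = g u @ g v"
    and f: "\<And>w. w \<in> lists X \<Longrightarrow> f w \<in> lists Y" and g: "\<And>w. w \<in> lists Y \<Longrightarrow> g w \<in> lists X"
    and f_rels: "\<And>l r. (l, r) \<in> S \<Longrightarrow> (f l, f r) \<in> presented_congruence Y T"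
    and g_rels: "\<And>l r. (l, r) \<in> T \<Longrightarrow> (g l, g r) \<in> presented_congruence X S"
    and gf: "\<And>w. w \<in> lists X \<Longrightarrow> (g (f w), w) \<in> presented_congruence X S"
    and fg: "\<And>w. w \<in> lists Y \<Longrightarrow> (f (g w), w) \<in> presented_congruence Y T"
  shows "presented_monoid X S \<cong> presented_monoid Y T"
proof -
  let ?C = "presented_congruence X S" and ?D = "presented_congruence Y T"
  let ?M = "presented_monoid X S" and ?N = "presented_monoid Y T"
  define h where "h = (\<lambda>K. \<Union>w\<in>K. ?D `` {f w})"
  note eqX = equiv_presented_congruence[OF X] and eqY = equiv_presented_congruence[OF Y]
  have fC: "(f w, f w') \<in> ?D" if "(w, w') \<in> ?C" for w w'
    using presented_congruence_map[of Y T f X S, OF Y f_app f f_rels that] .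
  have gD: "(g w, g w') \<in> ?C" if "(w, w') \<in> ?D" for w w'
    using presented_congruence_map[of X S g Y T, OF X g_app g g_rels that] .
  have h: "h (?C `` {w}) = ?D `` {f w}" if "w \<in> lists X" for w
  proof -
    have "congruent ?C (\<lambda>w. ?D `` {f w})"
      unfolding congruent_def using fC equiv_class_eq[OF eqY] by blast
    from UN_equiv_class[OF eqX this that] show ?thesis by (simp add: h_def)
  qed
  have carX: "carrier ?M = (\<lambda>w. ?C `` {w}) ` lists X"
    and carY: "carrier ?N = (\<lambda>w. ?D `` {w}) ` lists Y"
    by (auto simp: presented_monoid_def quotient_def)
  have hM: "h \<in> hom ?M ?N"
  proof (rule homI)
    fix K assume "K \<in> carrier ?M"
    then obtain w where "w \<in> lists X" "K = ?C `` {w}"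
      by (auto simp: carX simp del: in_lists_conv_set)
    then show "h K \<in> carrier ?N" using h f unfolding carY by blast
  next
    fix K L assume "K \<in> carrier ?M" "L \<in> carrier ?M"
    then obtain u v where "u \<in> lists X" "v \<in> lists X" "K = ?C `` {u}" "L = ?C `` {v}"
      by (auto simp: carX simp del: in_lists_conv_set)
    then show "h (K \<otimes>\<^bsub>?M\<^esub> L) = h K \<otimes>\<^bsub>?N\<^esub> h L"
      using h[of "u @ v"] h[of u] h[of v] f[of u] f[of v] presented_mult_class[OF X, of u v]
        presented_mult_class[OF Y, of "f u" "f v"]
      by (simp add: f_app append_in_lists_conv del: in_lists_conv_set)
  qed
  have "bij_betw h (carrier ?M) (carrier ?N)"
  proof (rule bij_betw_imageI)
    show "inj_on h (carrier ?M)"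
    proof (rule inj_onI)
      fix K L assume "K \<in> carrier ?M" "L \<in> carrier ?M" and e: "h K = h L"
      then obtain u v where uv: "u \<in> lists X" "v \<in> lists X" "K = ?C `` {u}" "L = ?C `` {v}"
        by (auto simp: carX simp del: in_lists_conv_set)
      with e h have "?D `` {f u} = ?D `` {f v}" by simp
      then have "(f u, f v) \<in> ?D" using eq_equiv_class[OF _ eqY f[OF uv(2)]] by blast
      then have "(g (f u), g (f v)) \<in> ?C" by (rule gD)
      then have "(u, v) \<in> ?C"
        using gf[OF uv(1)] gf[OF uv(2)] by (meson presented_congruence.sym presented_congruence.trans)
      then show "K = L" using uv equiv_class_eq[OF eqX] by simp
    qed
    show "h ` carrier ?M = carrier ?N"
    proof
      show "h ` carrier ?M \<subseteq> carrier ?N"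
        using hM by (auto simp: hom_def)
      show "carrier ?N \<subseteq> h ` carrier ?M"
      proof
        fix K assume "K \<in> carrier ?N"
        then obtain w where w: "w \<in> lists Y" "K = ?D `` {w}"
          by (auto simp: carY simp del: in_lists_conv_set)
        then have "K = h (?C `` {g w})"
          using h[OF g[OF w(1)]] equiv_class_eq[OF eqY fg[OF w(1)]] by simp
        then show "K \<in> h ` carrier ?M" using g[OF w(1)] by (auto simp: carX simp del: in_lists_conv_set)
      qed
    qed
  qed
  with hM show ?thesis unfolding is_iso_def iso_def by blast
qed

section \<open>Translation between letters and columns\<close>

interpretation plactic: braided_idempotent "columns n" codeL codeR 0 for n
  by (rule braided_columns)

abbreviation column_congruence :: "nat \<Rightarrow> (nat list \<times> nat list) set" where
  "column_congruence n \<equiv> presented_congruence (columns n) (plactic.rels n)"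

definition col :: "nat set \<Rightarrow> nat" where
  "col A = set_encode A"

definition to_columns :: "nat list \<Rightarrow> nat list" where
  "to_columns = map (\<lambda>i. col {i})"

definition to_letters :: "nat list \<Rightarrow> nat list" where
  "to_letters ws = concat (map (\<lambda>c. colword (set_decode c)) ws)"

lemma col_empty [simp]: "col {} = 0"
  by (simp add: col_def)

lemma col_decode [simp]: "col (set_decode c) = c"
  by (simp add: col_def)

lemma col_in_columns: "A \<subseteq> {1..n} \<Longrightarrow> col A \<in> columns n"
  by (simp add: columns_def col_def set_encode_inverse finite_subset)

lemma column_product:
  assumes "A \<subseteq> {1..n}" "B \<subseteq> {1..n}" "u \<in> lists (columns n)" "v \<in> lists (columns n)"
  shows "(u @ col A # col B # v,
    u @ col (colL A B) # col (colR A B) # v) \<in> column_congruence n"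
proof -
  have fin: "finite A" "finite B" using assms finite_subset by blast+
  have "([col A, col B], [col (colL A B), col (colR A B)])
      = plactic.swap_rel (col A) (col B)"
    using fin by (simp add: plactic.swap_rel_def codeL_def codeR_def col_def set_encode_inverse)
  then have "([col A, col B], [col (colL A B), col (colR A B)])
      \<in> plactic.rels n"
    using plactic.swap_rel_in col_in_columns assms by simp
  from presented_congruence.rel[OF assms(3,4) this] show ?thesis by simp
qed

lemma column_unit:
  assumes "u \<in> lists (columns n)" "v \<in> lists (columns n)"
  shows "(u @ col {} # v, u @ v) \<in> column_congruence n"
proof -
  have "([col {}], []) \<in> plactic.rels n" by (simp add: plactic.rels_def)
  from presented_congruence.rel[OF assms this] show ?thesis by simp
qed

lemma column_append:
  assumes "x \<in> {1..n}" "B \<subseteq> {1..n}" "\<And>b. b \<in> B \<Longrightarrow> b < x"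
    and "u \<in> lists (columns n)" "v \<in> lists (columns n)"
  shows "(u @ col {x} # col B # v, u @ col (insert x B) # v) \<in> column_congruence n"
proof -
  have "col (insert x B) \<in> columns n" using assms by (intro col_in_columns) auto
  \<comment> \<open>The column product leaves an empty column behind, which the unit relation
    removes.\<close>
  then have "((u @ [col (insert x B)]) @ col {} # v,
      (u @ [col (insert x B)]) @ v) \<in> column_congruence n"
    using assms by (intro column_unit) auto
  moreover have "(u @ col {x} # col B # v, u @ col (insert x B) # col {} # v)
      \<in> column_congruence n"
    using column_product[OF _ assms(2,4,5), of "{x}"] assms(1,3) by (simp add: col_append)
  ultimately show ?thesis using presented_congruence.trans by simp blast
qed

lemma column_bump:
  assumes "x \<in> {1..n}" "B \<subseteq> {1..n}" "y \<in> B" "x \<le> y" "\<And>b. b \<in> B \<Longrightarrow> x \<le> b \<Longrightarrow> y \<le> b"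
    and "u \<in> lists (columns n)" "v \<in> lists (columns n)"
  shows "(u @ col {x} # col B # v, u @ col (insert x (B - {y})) # col {y} # v)
    \<in> column_congruence n"
  using column_product[OF _ assms(2,6,7), of "{x}"] assms(1) col_bump[OF assms(3-5)]
  by simp

text \<open>The column is built up from its smallest letter, each new largest letter being attached
  by \<open>column_append\<close>; the empty column comes from the unit relation read
  backwards.\<close>

lemma to_columns_colword:
  assumes "finite A" "A \<subseteq> {1..n}"
  shows "(to_columns (colword A), [col A]) \<in> column_congruence n"
  using assms
proof (induction A rule: finite_linorder_max_induct)
  case empty
  show ?case using presented_congruence.sym[OF column_unit[of "[]" n "[]"]]
    by (simp add: to_columns_def)
next
  case (insert x A)
  then have x: "x \<in> {1..n}" "A \<subseteq> {1..n}" by auto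
  have "col {x} \<in> columns n" using x by (intro col_in_columns) auto
  with insert.IH[OF x(2)]
  have "(col {x} # to_columns (colword A), [col {x}, col A]) \<in> column_congruence n"
    by (rule congruence_Cons)
  moreover have "([col {x}, col A], [col (insert x A)]) \<in> column_congruence n"
    using column_append[OF x, of "[]" "[]"] insert.hyps by simp
  ultimately have "(col {x} # to_columns (colword A), [col (insert x A)])
      \<in> column_congruence n"
    by (rule presented_congruence.trans)
  then show ?case using insert.hyps by (simp add: colword_insert_max to_columns_def)
qed

lemma to_columns_in:
  assumes "w \<in> lists {1..n}"
  shows "to_columns w \<in> lists (columns n)"
  using assms by (auto simp: to_columns_def intro!: col_in_columns)

lemma to_letters_in:
  assumes "w \<in> lists (columns n)"
  shows "to_letters w \<in> lists {1..n}"
  using assms by (fastforce simp: to_letters_def columns_def)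

text \<open>Each Knuth relation is a single bump. On one side the last two letters form a column
  into which the first is inserted; on the other the first two letters form the resulting left
  column, and the bumped letter follows.\<close>

lemma to_columns_knuth:
  assumes "(l, r) \<in> plactic_relations n"
  shows "(to_columns l, to_columns r) \<in> column_congruence n"
proof -
  have col_in: "col {i} \<in> columns n" if "i \<in> {1..n}" for i
    using that by (intro col_in_columns) auto
  from assms have "(\<exists>x y z. l = [x, z, y] \<and> r = [z, x, y] \<and> {x, y, z} \<subseteq> {1..n} \<and> x \<le> y \<and> y < z) \<or>
      (\<exists>x y z. l = [y, x, z] \<and> r = [y, z, x] \<and> {x, y, z} \<subseteq> {1..n} \<and> x < y \<and> y \<le> z)"
    by (simp add: plactic_relations_def)
  then show ?thesis
  proof (elim disjE exE conjE)
    fix x y z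
    assume lr: "l = [x, z, y]" "r = [z, x, y]" and n: "{x, y, z} \<subseteq> {1..n}"
      and less: "x \<le> y" "y < z"
    have e: "{z, y} - {y} = {z}" using less by auto
    have "([] @ col {x} # col {z, y} # [], [] @ col (insert x ({z, y} - {y})) # col {y} # [])
        \<in> column_congruence n"
      by (rule column_bump) (use n less in auto)
    moreover have "([col {x}] @ col {z} # col {y} # [], [col {x}] @ col {z, y} # [])
        \<in> column_congruence n"
      by (rule column_append) (use n less col_in in auto)
    moreover have "([] @ col {z} # col {x} # [col {y}], [] @ col {z, x} # [col {y}])
        \<in> column_congruence n"
      by (rule column_append) (use n less col_in in auto)
    ultimately have "([col {x}, col {z}, col {y}], [col {z}, col {x}, col {y}])
        \<in> column_congruence n"
      unfolding e insert_commute[of z x] append_Nil append_Cons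
      by (metis presented_congruence.sym presented_congruence.trans)
    then show ?thesis by (simp add: lr to_columns_def)
  next
    fix x y z
    assume lr: "l = [y, x, z]" "r = [y, z, x]" and n: "{x, y, z} \<subseteq> {1..n}"
      and less: "x < y" "y \<le> z"
    have e: "{z, x} - {z} = {x}" using less by auto
    have "([] @ col {y} # col {z, x} # [], [] @ col (insert y ({z, x} - {z})) # col {z} # [])
        \<in> column_congruence n"
      by (rule column_bump) (use n less in auto)
    moreover have "([col {y}] @ col {z} # col {x} # [], [col {y}] @ col {z, x} # [])
        \<in> column_congruence n"
      by (rule column_append) (use n less col_in in auto)
    moreover have "([] @ col {y} # col {x} # [col {z}], [] @ col {y, x} # [col {z}])
        \<in> column_congruence n"
      by (rule column_append) (use n less col_in in auto)
    ultimately have "([col {y}, col {x}, col {z}], [col {y}, col {z}, col {x}])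
        \<in> column_congruence n"
      unfolding e append_Nil append_Cons
      by (metis presented_congruence.sym presented_congruence.trans)
    then show ?thesis by (simp add: lr to_columns_def)
  qed
qed

lemma to_letters_rels:
  assumes "(l, r) \<in> plactic.rels n"
  shows "(to_letters l, to_letters r) \<in> plac n"
proof -
  from assms consider "l = [0]" "r = []"
    | a b where "a \<in> columns n" "b \<in> columns n" "l = [a, b]" "r = [codeL a b, codeR a b]"
    by (auto simp: plactic.rels_def plactic.swap_rel_def)
  then show ?thesis
  proof cases
    case 1
    then show ?thesis using presented_congruence.refl[of "[]"] by (simp add: to_letters_def)
  next
    case 2
    then show ?thesis
      using plac_column_product[of "set_decode a" n "set_decode b"]
      by (simp add: to_letters_def columns_def)
  qed
qed

lemma to_columns_to_letters:
  assumes "w \<in> lists (columns n)"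
  shows "(to_columns (to_letters w), w) \<in> column_congruence n"
  using assms
proof (induction w rule: list.induct)
  case Nil
  show ?case
    using presented_congruence.refl[of "[]"] by (simp add: to_columns_def to_letters_def)
next
  case (Cons c w)
  then have c: "set_decode c \<subseteq> {1..n}" "c \<in> columns n" and w: "w \<in> lists (columns n)"
    by (auto simp: columns_def)
  have "(to_columns (colword (set_decode c)), [c]) \<in> column_congruence n"
    using to_columns_colword[OF _ c(1)] by simp
  from presented_congruence_append[OF plactic.presentation_rels this Cons.IH[OF w]]
  show ?case by (simp add: to_columns_def to_letters_def)
qed

lemma to_letters_to_columns: "to_letters (to_columns w) = w"
  by (induction w) (simp_all add: to_letters_def to_columns_def col_def set_encode_inverse
      del: set_encode_insert)

theorem corollary3p5:
  fixes n :: nat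
  assumes "1 \<le> n"
  shows "fdt_monoid (plactic_monoid n)"
proof -
  have "presented_monoid (columns n) (plactic.rels n) \<cong> plactic_monoid n"
    unfolding plactic_monoid_def
  proof (rule presented_monoid_iso[of _ _ _ _ to_letters to_columns])
    show "to_letters (u @ v) = to_letters u @ to_letters v" for u v
      by (simp add: to_letters_def)
    show "to_columns (u @ v) = to_columns u @ to_columns v" for u v
      by (simp add: to_columns_def)
    show "(to_letters (to_columns w), w) \<in> plac n" if "w \<in> lists {1..n}" for w
      unfolding to_letters_to_columns using that by (rule presented_congruence.refl)
  qed (fact plactic.presentation_rels presentation_plactic to_letters_in to_columns_in
      to_letters_rels to_columns_knuth to_columns_to_letters)+
  then show ?thesis
    using plactic.fdt_presentation_rels[of n] unfolding fdt_monoid_def by blast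
qed

end
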